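(* Consider the three-dimensional model for count variables $(X,Y,Z)$ $$X\mid Y,Z\;\overset{d}{=}\;\sum_{i=1}^YW_{1i}+\sum_{i=1}^ZW_{2i}+\epsilon_1,$$ $$Y\mid X,Z\;\overset{d}{=}\;\sum_{i=1}^XW_{3i}+\sum_{i=1}^ZW_{4i}+\epsilon_2,$$ $$Z\mid X,Y\;\overset{d}{=}\;\sum_{i=1}^XW_{5i}+\sum_{i=1}^YW_{6i}+\epsilon_3,$$ in which the (Bernoulli) sequences $(W_{1i}),(W_{2i}),\dots,(W_{6i})$ are i.i.d. given stochastic probability parameters $p_1,p_2,\dots,p_6$, respectively. Then this model does not have any non-degenerate solution.
   Context: Count variables are $\mathbb{N}_0$-valued, $\mathbb{N}_0=\{0,1,2,\dots\}$; $\epsilon_1,\epsilon_2,\epsilon_3$ are count variables and $\overset{d}{=}$ denotes equality in distribution. A solution is a joint distribution of $(X,Y,Z)$ that leads to the postulated conditional distributions; non-degenerate means that $W_{1i},\dots,W_{6i}$ should not be constant variables such as zero. This is the random coefficient modification of the compound autoregressive model, in which each sequence $(W_{ji})_i$ is i.i.d. unconditionally; the other assumptions of that model are: $(W_{1i})$ and $(W_{2i})$ are mutually independent and independent of $Y,Z$ and $\epsilon_1$; $(W_{3i})$ and $(W_{4i})$ are mutually independent and independent of $X,Z$ and $\epsilon_2$; $(W_{5i})$ and $(W_{6i})$ are mutually independent and independent of $X,Y$ and $\epsilon_3$; $\epsilon_1$ is independent of $Y,Z$, $\epsilon_2$ of $X,Z$, and $\epsilon_3$ of $X,Y$.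
   Formalization: The solution X=Y=Z=0 almost surely is excluded: with all innovations zero it satisfies the three equations for arbitrary non-constant W's (all sums are empty), so the claim without this exclusion is false. *)

theory Defs
  imports "HOL-Probability.Probability"
begin

context prob_space
begin

(* Independence of two random variables. The library's indep_var needs both variables to take
   values in the same type, whereas here one of them is a sequence and the other a number or a
   tuple. *)
definition indep_rv ::
  "'b measure \<Rightarrow> ('a \<Rightarrow> 'b) \<Rightarrow> 'c measure \<Rightarrow> ('a \<Rightarrow> 'c) \<Rightarrow> bool" where
  "indep_rv N U N' V \<longleftrightarrow>
     random_variable N U \<and> random_variable N' V \<and>
     indep_set (sets (vimage_algebra (space M) U N)) (sets (vimage_algebra (space M) V N'))"

(* The sequence W is i.i.d. Bernoulli(p) conditionally on the random variable p: given the
   sigma-algebra generated by p, the finite-dimensional laws of W are products of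
   Bernoulli(p) laws. Constant p is allowed. *)
definition cond_iid_bernoulli :: "('a \<Rightarrow> real) \<Rightarrow> (nat \<Rightarrow> 'a \<Rightarrow> nat) \<Rightarrow> bool" where
  "cond_iid_bernoulli p W \<longleftrightarrow>
     random_variable borel p \<and> (AE \<omega> in M. 0 \<le> p \<omega> \<and> p \<omega> \<le> 1) \<and>
     (\<forall>i. random_variable (count_space UNIV) (W i)) \<and>
     (\<forall>I (b :: nat \<Rightarrow> bool). finite I \<longrightarrow>
        (AE \<omega> in M.
           real_cond_exp M (vimage_algebra (space M) p borel)
             (indicator {\<omega> \<in> space M. \<forall>i\<in>I. W i \<omega> = of_bool (b i)}) \<omega>
           = (\<Prod>i\<in>I. pmf (bernoulli_pmf (p \<omega>)) (b i))))"

(* One equation U | V1, V2 ~ sum_{i=1}^{V1} A_i + sum_{i=1}^{V2} B_i + e of the model.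
   Sequences are indexed from 0, so the sums run over i < V1 and i < V2. The three
   independence conditions together say that A, B, e and (V1, V2) are mutually independent;
   nothing is assumed about independence from U. In the last condition, a conditioning event
   of probability 0 makes both sides 0, so only values (v1, v2) of positive probability
   matter. *)
definition rc_equation ::
  "('a \<Rightarrow> nat) \<Rightarrow> ('a \<Rightarrow> nat) \<Rightarrow> ('a \<Rightarrow> nat) \<Rightarrow>
   (nat \<Rightarrow> 'a \<Rightarrow> nat) \<Rightarrow> (nat \<Rightarrow> 'a \<Rightarrow> nat) \<Rightarrow> ('a \<Rightarrow> nat) \<Rightarrow> bool" where
  "rc_equation U V1 V2 A B e \<longleftrightarrow>
     (let S = (\<Pi>\<^sub>M i\<in>(UNIV :: nat set). count_space (UNIV :: nat set)) in
        indep_rv S (\<lambda>\<omega> i. A i \<omega>) S (\<lambda>\<omega> i. B i \<omega>) \<and>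
        indep_rv (S \<Otimes>\<^sub>M S) (\<lambda>\<omega>. (\<lambda>i. A i \<omega>, \<lambda>i. B i \<omega>))
                 (count_space UNIV) (\<lambda>\<omega>. (V1 \<omega>, V2 \<omega>, e \<omega>)) \<and>
        indep_rv (count_space UNIV) e (count_space UNIV) (\<lambda>\<omega>. (V1 \<omega>, V2 \<omega>))) \<and>
     (\<forall>u v1 v2.
        \<P>(\<omega> in M. U \<omega> = u \<bar> V1 \<omega> = v1 \<and> V2 \<omega> = v2) =
        \<P>(\<omega> in M. (\<Sum>i<V1 \<omega>. A i \<omega>) + (\<Sum>i<V2 \<omega>. B i \<omega>) + e \<omega> = u
              \<bar> V1 \<omega> = v1 \<and> V2 \<omega> = v2))"

end

(* W j i, p j and \<epsilon> j are W_{j,i+1}, p_j and epsilon_j; only j = 1..6 (respectively 1..3)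
   is relevant. *)
locale random_coefficient_model = prob_space M
  for M :: "'a measure" +
  fixes X Y Z :: "'a \<Rightarrow> nat"
    and W :: "nat \<Rightarrow> nat \<Rightarrow> 'a \<Rightarrow> nat"
    and p :: "nat \<Rightarrow> 'a \<Rightarrow> real"
    and \<epsilon> :: "nat \<Rightarrow> 'a \<Rightarrow> nat"
  assumes measurable_XYZ:
      "random_variable (count_space UNIV) X"
      "random_variable (count_space UNIV) Y"
      "random_variable (count_space UNIV) Z"
    and bernoulli_W: "\<And>j. j \<in> {1..6} \<Longrightarrow> cond_iid_bernoulli (p j) (W j)"
    and equation_X: "rc_equation X Y Z (W 1) (W 2) (\<epsilon> 1)"
    and equation_Y: "rc_equation Y X Z (W 3) (W 4) (\<epsilon> 2)"
    and equation_Z: "rc_equation Z X Y (W 5) (W 6) (\<epsilon> 3)"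

(* The point mass X = Y = Z = 0 with zero innovations satisfies the model for arbitrary
   non-constant W, since then all random sums are empty; it has to be excluded separately
   when non-degenerate solutions are considered. *)
definition non_degenerate :: "'a measure \<Rightarrow> (nat \<Rightarrow> nat \<Rightarrow> 'a \<Rightarrow> nat) \<Rightarrow> bool" where
  "non_degenerate M W \<longleftrightarrow> (\<forall>j\<in>{1..6}. \<forall>i. \<not> (\<exists>c. AE \<omega> in M. W j i \<omega> = c))"

end

theory Submission
  imports Defs "HOL-Computational_Algebra.Polynomial_FPS"
begin

text \<open>Write \<open>A\<^sub>k(s) = E (1 - p + p s)\<^sup>k\<close>, a polynomial of degree \<open>k\<close>, so that the generating function of
  \<open>X\<close> given \<open>Y = y, Z = z\<close> is \<open>E\<^sub>1 A\<^sub>y B\<^sub>z\<close>, and similarly for \<open>Y\<close> and \<open>Z\<close>. Each value of the joint law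
  near the smallest point of its support can be computed via two of the three conditionals. To first
  order above the minimum this shows that raising \<open>Y\<close> by one and raising \<open>Z\<close> by some \<open>K\<close> have the same
  effect on the law of \<open>X\<close>; the degrees of the generating functions force \<open>K = 1\<close>. To second order
  it gives a relation
  \<open>A\<^sub>m A\<^sub>m\<^sub>+\<^sub>2 = a A\<^sub>m\<^sub>+\<^sub>1\<^sup>2 + b A\<^sub>m\<^sub>+\<^sub>1 A\<^sub>m\<close>, which only holds if \<open>p\<close> is almost surely constant. With all
  parameters constant the conditionals are incompatible by a computation with the values at \<open>(2,1,0)\<close>
  and \<open>(2,1,1)\<close>. Parameters with values in \<open>{0,1}\<close>, for which the unit steps used here may be
  impossible, are excluded beforehand.\<close>

unbundle no vec_syntax
unbundle fps_syntax

section \<open>Mixed binomial generating functions\<close>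

text \<open>Generating function of the binomial law with \<open>k\<close> trials and random success
  probability \<open>p\<close>, given by coefficients so that they can be read off as moments of
  \<open>p\<close>. The closed form is \<open>poly_mix_poly\<close>.\<close>

definition mix_poly :: "'a measure \<Rightarrow> ('a \<Rightarrow> real) \<Rightarrow> nat \<Rightarrow> real poly" where
  "mix_poly M p k =
     (\<Sum>i\<le>k. monom (real (k choose i) * (\<integral>\<omega>. p \<omega> ^ i * (1 - p \<omega>) ^ (k - i) \<partial>M)) i)"

lemma coeff_mix_poly:
  "coeff (mix_poly M p k) i =
     real (k choose i) * (\<integral>\<omega>. p \<omega> ^ i * (1 - p \<omega>) ^ (k - i) \<partial>M)"
  by (auto simp: mix_poly_def coeff_sum if_distrib cong: if_cong)

text \<open>Collects what the algebra uses about \<open>mix_poly\<close>, freeing it from the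
  measure space. \<open>dichotomy\<close> separates parameters that are almost surely 0 or 1 from
  all others.\<close>

locale bernoulli_family =
  fixes A :: "nat \<Rightarrow> real poly"
  assumes coeff_nonneg: "0 \<le> coeff (A k) i"
    and degree_eq [simp]: "degree (A k) = k"
    and coeff_0_pos: "0 < coeff (A k) 0"
    and dichotomy:
      "(\<forall>k i. i \<le> k \<longrightarrow> 0 < coeff (A k) i) \<or> (\<forall>k i. 0 < i \<and> i < k \<longrightarrow> coeff (A k) i = 0)"
    and rigid:
      "A m * A (m + 2) = smult a (A (m + 1) ^ 2) + smult b (A (m + 1) * A m) \<Longrightarrow>
         \<exists>q. 0 < q \<and> q < 1 \<and> (\<forall>k. A k = [:1 - q, q:] ^ k)"
begin

lemma nonzero [simp]: "A k \<noteq> 0"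
  using coeff_0_pos[of k] by auto

lemma lead_pos: "0 < coeff (A k) k"
  using coeff_nonneg[of k k] leading_coeff_neq_0[OF nonzero[of k]] by simp

end

text \<open>\<open>c\<close> is the mean of \<open>u\<close> under the weight \<open>w\<close>, so
  expanding the square gives a weighted variance: the defect in the Cauchy--Schwarz
  inequality.\<close>

lemma (in prob_space) integral_weighted_variance:
  fixes w u :: "'a \<Rightarrow> real"
  assumes [measurable]: "random_variable borel w" "random_variable borel u"
    and bounds: "AE \<omega> in M. 0 \<le> w \<omega> \<and> w \<omega> \<le> 1 \<and> 0 \<le> u \<omega> \<and> u \<omega> \<le> 1"
    and pos: "0 < (\<integral>\<omega>. w \<omega> \<partial>M)"
  defines "c \<equiv> (\<integral>\<omega>. w \<omega> * u \<omega> \<partial>M) / (\<integral>\<omega>. w \<omega> \<partial>M)"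
  shows "integrable M (\<lambda>\<omega>. w \<omega> * (u \<omega> - c)\<^sup>2)"
    and "(\<integral>\<omega>. w \<omega> * (u \<omega> - c)\<^sup>2 \<partial>M) * (\<integral>\<omega>. w \<omega> \<partial>M) =
      (\<integral>\<omega>. w \<omega> \<partial>M) * (\<integral>\<omega>. w \<omega> * (u \<omega>)\<^sup>2 \<partial>M) - (\<integral>\<omega>. w \<omega> * u \<omega> \<partial>M)\<^sup>2"
proof -
  have i0: "integrable M w"
    by (rule integrable_const_bound[where B = 1], use bounds in eventually_elim) auto
  have i1: "integrable M (\<lambda>\<omega>. w \<omega> * u \<omega>)"
    by (rule integrable_const_bound[where B = 1], use bounds in eventually_elim)
       (auto simp: abs_mult intro!: mult_le_one)
  have i2: "integrable M (\<lambda>\<omega>. w \<omega> * (u \<omega>)\<^sup>2)"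
    by (rule integrable_const_bound[where B = 1], use bounds in eventually_elim)
       (auto simp: abs_mult power_le_one intro!: mult_le_one)
  have eq: "(\<lambda>\<omega>. w \<omega> * (u \<omega> - c)\<^sup>2) =
      (\<lambda>\<omega>. w \<omega> * (u \<omega>)\<^sup>2 - 2 * c * (w \<omega> * u \<omega>) + c\<^sup>2 * w \<omega>)"
    by (auto simp: power2_eq_square algebra_simps)
  show "integrable M (\<lambda>\<omega>. w \<omega> * (u \<omega> - c)\<^sup>2)"
    unfolding eq using i0 i1 i2 by auto
  have "(\<integral>\<omega>. w \<omega> * (u \<omega> - c)\<^sup>2 \<partial>M) =
      (\<integral>\<omega>. w \<omega> * (u \<omega>)\<^sup>2 \<partial>M) - 2 * c * (\<integral>\<omega>. w \<omega> * u \<omega> \<partial>M) + c\<^sup>2 * (\<integral>\<omega>. w \<omega> \<partial>M)"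
    unfolding eq using i0 i1 i2 by simp
  then show "(\<integral>\<omega>. w \<omega> * (u \<omega> - c)\<^sup>2 \<partial>M) * (\<integral>\<omega>. w \<omega> \<partial>M) =
      (\<integral>\<omega>. w \<omega> \<partial>M) * (\<integral>\<omega>. w \<omega> * (u \<omega>)\<^sup>2 \<partial>M) - (\<integral>\<omega>. w \<omega> * u \<omega> \<partial>M)\<^sup>2"
    using pos by (simp add: c_def field_simps power2_eq_square)
qed

section \<open>Moments of a random success probability\<close>

locale random_parameter = prob_space M for M :: "'a measure" +
  fixes p :: "'a \<Rightarrow> real"
  assumes p_meas [measurable]: "random_variable borel p"
    and p_bounds: "AE \<omega> in M. 0 \<le> p \<omega> \<and> p \<omega> \<le> 1"
    and not_zero: "\<not> (AE \<omega> in M. p \<omega> = 0)"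
    and not_one: "\<not> (AE \<omega> in M. p \<omega> = 1)"
begin

abbreviation "mom i j \<equiv> \<integral>\<omega>. p \<omega> ^ i * (1 - p \<omega>) ^ j \<partial>M"

lemma integrable_mom: "integrable M (\<lambda>\<omega>. p \<omega> ^ i * (1 - p \<omega>) ^ j)"
  by (rule integrable_const_bound[where B = 1])
     (use p_bounds in \<open>auto simp: abs_mult power_le_one power_abs intro!: mult_le_one\<close>)

lemma AE_mom_nonneg: "AE \<omega> in M. 0 \<le> p \<omega> ^ i * (1 - p \<omega>) ^ j"
  using p_bounds by eventually_elim auto

lemma mom_nonneg: "0 \<le> mom i j"
  by (intro integral_nonneg_AE AE_mom_nonneg)

lemma mom_eq_0_iff: "mom i j = 0 \<longleftrightarrow> (AE \<omega> in M. p \<omega> ^ i * (1 - p \<omega>) ^ j = 0)"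
  by (rule integral_nonneg_eq_0_iff_AE[OF integrable_mom AE_mom_nonneg])

lemma mom_power_pos: "0 < mom i 0" "0 < mom 0 i"
proof -
  have "mom i 0 \<noteq> 0"
    unfolding mom_eq_0_iff using not_zero by (auto elim: eventually_mono)
  then show "0 < mom i 0" using mom_nonneg[of i 0] by simp
  have "mom 0 i \<noteq> 0"
    unfolding mom_eq_0_iff using not_one by (auto elim: eventually_mono)
  then show "0 < mom 0 i" using mom_nonneg[of 0 i] by simp
qed

lemma poly_mix_poly: "poly (mix_poly M p k) s = (\<integral>\<omega>. (1 - p \<omega> + p \<omega> * s) ^ k \<partial>M)"
proof -
  have "(\<integral>\<omega>. (1 - p \<omega> + p \<omega> * s) ^ k \<partial>M) =
      (\<integral>\<omega>. (\<Sum>i\<le>k. real (k choose i) * s ^ i * (p \<omega> ^ i * (1 - p \<omega>) ^ (k - i))) \<partial>M)"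
    by (intro Bochner_Integration.integral_cong refl)
       (subst add.commute, subst binomial_ring, simp add: power_mult_distrib ac_simps)
  also have "\<dots> = (\<Sum>i\<le>k. real (k choose i) * s ^ i * mom i (k - i))"
    by (subst Bochner_Integration.integral_sum) (auto intro!: integrable_mom)
  also have "\<dots> = poly (mix_poly M p k) s"
    by (simp add: mix_poly_def poly_sum poly_monom ac_simps)
  finally show ?thesis by simp
qed

lemma degree_mix_poly: "degree (mix_poly M p k) = k"
proof (rule antisym)
  show "degree (mix_poly M p k) \<le> k"
    by (rule degree_le) (simp add: coeff_mix_poly)
  show "k \<le> degree (mix_poly M p k)"
    by (rule le_degree) (use mom_power_pos(1)[of k] in \<open>simp add: coeff_mix_poly\<close>)
qed

text \<open>Inner coefficients are positive multiples of moments of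
  \<open>p ^ i * (1 - p) ^ j\<close> with positive exponents. These all vanish if \<open>p\<close>
  is almost surely 0 or 1; otherwise \<open>p\<close> lies strictly between with positive
  probability and every moment is positive.\<close>

lemma dichotomy_mix_poly:
  "(\<forall>k i. i \<le> k \<longrightarrow> 0 < coeff (mix_poly M p k) i) \<or>
   (\<forall>k i. 0 < i \<and> i < k \<longrightarrow> coeff (mix_poly M p k) i = 0)"
proof (cases "AE \<omega> in M. p \<omega> = 0 \<or> p \<omega> = 1")
  case True
  have "mom i j = 0" if "0 < i" "0 < j" for i j
    unfolding mom_eq_0_iff using True by eventually_elim (use that in auto)
  then show ?thesis by (auto simp: coeff_mix_poly)
next
  case False
  have "0 < mom i j" for i j
  proof -
    have "\<not> (AE \<omega> in M. p \<omega> ^ i * (1 - p \<omega>) ^ j = 0)"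
      using False by (rule contrapos_nn) (auto elim!: eventually_mono)
    then have "mom i j \<noteq> 0"
      unfolding mom_eq_0_iff .
    then show ?thesis using mom_nonneg[of i j] by simp
  qed
  then show ?thesis by (auto simp: coeff_mix_poly)
qed

text \<open>The relation holds at \<open>s = 1\<close>, so \<open>a + b = 1\<close>; its leading coefficients and the
  Cauchy--Schwarz inequality for the moments of \<open>p\<close> give \<open>a \<ge> 1\<close>. At \<open>s = 1/2\<close> it then becomes
  the reverse Cauchy--Schwarz inequality for \<open>1 - p/2\<close>.\<close>
lemma rigid_mix_poly:
  fixes m :: nat
  defines "A \<equiv> mix_poly M p"
  assumes rel: "A m * A (m + 2) = smult a (A (m + 1) ^ 2) + smult b (A (m + 1) * A m)"
  shows "\<exists>q. 0 < q \<and> q < 1 \<and> (\<forall>k. A k = [:1 - q, q:] ^ k)"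
proof -
  have deg: "degree (A k) = k" for k
    by (simp add: A_def degree_mix_poly)
  have lead: "coeff (A k) k = mom k 0" for k
    by (simp add: A_def coeff_mix_poly)
  have "poly (A m * A (m + 2)) 1 = poly (smult a (A (m + 1) ^ 2) + smult b (A (m + 1) * A m)) 1"
    using rel by simp
  then have ab: "a + b = 1"
    by (simp add: A_def poly_mix_poly prob_space)
  have "coeff (A m * A (m + 2)) (m + (m + 2)) = mom m 0 * mom (m + 2) 0"
    using coeff_mult_degree_sum[of "A m" "A (m + 2)"] by (simp add: deg lead)
  moreover have "coeff (A (m + 1) ^ 2) (m + (m + 2)) = (mom (m + 1) 0)\<^sup>2"
    using coeff_mult_degree_sum[of "A (m + 1)" "A (m + 1)"]
    by (simp add: deg lead power2_eq_square)
  \<comment> \<open>This product has degree at most \<open>2 * m + 1\<close>, so \<open>b\<close>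
    drops out of the top coefficient.\<close>
  moreover have "coeff (A (m + 1) * A m) (m + (m + 2)) = 0"
    by (rule coeff_eq_0) (use degree_mult_le[of "A (m + 1)" "A m"] in \<open>simp add: deg\<close>)
  ultimately have top: "mom m 0 * mom (m + 2) 0 = a * (mom (m + 1) 0)\<^sup>2"
    using arg_cong[OF rel, of "\<lambda>P. coeff P (m + (m + 2))"] by simp
  have var_top: "0 \<le> mom m 0 * mom (m + 2) 0 - (mom (m + 1) 0)\<^sup>2"
  proof -
    let ?c = "(\<integral>\<omega>. p \<omega> ^ m * p \<omega> \<partial>M) / (\<integral>\<omega>. p \<omega> ^ m \<partial>M)"
    have eq: "(\<integral>\<omega>. p \<omega> ^ m * (p \<omega> - ?c)\<^sup>2 \<partial>M) * (\<integral>\<omega>. p \<omega> ^ m \<partial>M) =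
        (\<integral>\<omega>. p \<omega> ^ m \<partial>M) * (\<integral>\<omega>. p \<omega> ^ m * (p \<omega>)\<^sup>2 \<partial>M) - (\<integral>\<omega>. p \<omega> ^ m * p \<omega> \<partial>M)\<^sup>2"
      by (rule integral_weighted_variance)
         (use p_bounds mom_power_pos(1)[of m] in \<open>auto simp: power_le_one\<close>)
    have "0 \<le> (\<integral>\<omega>. p \<omega> ^ m * (p \<omega> - ?c)\<^sup>2 \<partial>M)"
      by (rule integral_nonneg_AE) (use p_bounds in auto)
    moreover have "0 \<le> (\<integral>\<omega>. p \<omega> ^ m \<partial>M)"
      using mom_power_pos(1)[of m] by simp
    ultimately have "0 \<le> (\<integral>\<omega>. p \<omega> ^ m * (p \<omega> - ?c)\<^sup>2 \<partial>M) * (\<integral>\<omega>. p \<omega> ^ m \<partial>M)"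
      by (rule mult_nonneg_nonneg)
    moreover have "(\<integral>\<omega>. p \<omega> ^ m * (p \<omega>)\<^sup>2 \<partial>M) = mom (m + 2) 0"
        "(\<integral>\<omega>. p \<omega> ^ m * p \<omega> \<partial>M) = mom (m + 1) 0"
      by (simp_all add: power2_eq_square ac_simps)
    ultimately show ?thesis
      unfolding eq by simp
  qed
  have "1 \<le> a"
  proof (rule ccontr)
    assume "\<not> 1 \<le> a"
    then have "a * (mom (m + 1) 0)\<^sup>2 < 1 * (mom (m + 1) 0)\<^sup>2"
      using mom_power_pos(1)[of "m + 1"] by (intro mult_strict_right_mono) auto
    then show False using var_top top by simp
  qed
  \<comment> \<open>Evaluating at 1/2 keeps the base between 1/2 and 1, so that all
    \<open>H k\<close> are positive even if \<open>p\<close> reaches 1.\<close>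
  define h where "h = (\<lambda>\<omega>. 1 - p \<omega> + p \<omega> * (1/2))"
  have h_meas [measurable]: "h \<in> borel_measurable M" by (simp add: h_def)
  have h_bounds: "AE \<omega> in M. 1/2 \<le> h \<omega> \<and> h \<omega> \<le> 1"
    using p_bounds by eventually_elim (auto simp: h_def)
  define H where "H k = (\<integral>\<omega>. h \<omega> ^ k \<partial>M)" for k
  have AH: "poly (A k) (1/2) = H k" for k
    by (simp add: A_def poly_mix_poly H_def h_def)
  have h_int: "integrable M (\<lambda>\<omega>. h \<omega> ^ k)" for k
    by (rule integrable_const_bound[where B = 1], use h_bounds in eventually_elim)
       (auto simp: power_le_one)
  have H_pos: "0 < H k" for k
  proof -
    have "(\<integral>\<omega>. (1/2) ^ k \<partial>M) \<le> H k"
      unfolding H_def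
      by (rule integral_mono_AE[OF _ h_int], simp, use h_bounds in eventually_elim)
         (auto simp del: power_one_over intro!: power_mono)
    then have "(1/2) ^ k \<le> H k" by (simp add: prob_space)
    then show ?thesis by (rule less_le_trans[rotated]) simp
  qed
  have H_mono: "H (m + 1) \<le> H m"
    unfolding H_def
    by (rule integral_mono_AE[OF h_int h_int], use h_bounds in eventually_elim)
       (auto intro!: mult_left_le_one_le)
  have "H m * H (m + 2) = a * (H (m + 1))\<^sup>2 + b * (H (m + 1) * H m)"
    using arg_cong[OF rel, of "\<lambda>P. poly P (1/2)"] unfolding poly_mult poly_add poly_smult poly_power AH .
  also have "\<dots> = (H (m + 1))\<^sup>2 + (a - 1) * (H (m + 1) * (H (m + 1) - H m))"
  proof -
    have "b = 1 - a" using ab by simp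
    show ?thesis unfolding \<open>b = 1 - a\<close> by (simp add: power2_eq_square algebra_simps)
  qed
  also have "\<dots> \<le> (H (m + 1))\<^sup>2"
    using \<open>1 \<le> a\<close> H_mono H_pos[of "m + 1"] by (simp add: mult_nonneg_nonpos)
  finally have le: "H m * H (m + 2) \<le> (H (m + 1))\<^sup>2" .
  define c where "c = (\<integral>\<omega>. h \<omega> ^ m * h \<omega> \<partial>M) / (\<integral>\<omega>. h \<omega> ^ m \<partial>M)"
  have hb: "AE \<omega> in M. 0 \<le> h \<omega> ^ m \<and> h \<omega> ^ m \<le> 1 \<and> 0 \<le> h \<omega> \<and> h \<omega> \<le> 1"
    using h_bounds by eventually_elim (auto simp: power_le_one)
  have Hm: "0 < (\<integral>\<omega>. h \<omega> ^ m \<partial>M)" using H_pos[of m] by (simp add: H_def)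
  have int: "integrable M (\<lambda>\<omega>. h \<omega> ^ m * (h \<omega> - c)\<^sup>2)"
    unfolding c_def by (rule integral_weighted_variance(1)[OF _ _ hb Hm]) auto
  have "(\<integral>\<omega>. h \<omega> ^ m * (h \<omega>)\<^sup>2 \<partial>M) = H (m + 2)" "(\<integral>\<omega>. h \<omega> ^ m * h \<omega> \<partial>M) = H (m + 1)"
      "(\<integral>\<omega>. h \<omega> ^ m \<partial>M) = H m"
    by (simp_all add: H_def power2_eq_square ac_simps)
  then have "(\<integral>\<omega>. h \<omega> ^ m * (h \<omega> - c)\<^sup>2 \<partial>M) * H m = H m * H (m + 2) - (H (m + 1))\<^sup>2"
    unfolding c_def using integral_weighted_variance(2)[OF _ _ hb Hm] by simp
  then have "(\<integral>\<omega>. h \<omega> ^ m * (h \<omega> - c)\<^sup>2 \<partial>M) * H m \<le> 0 * H m"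
    using le by simp
  then have "(\<integral>\<omega>. h \<omega> ^ m * (h \<omega> - c)\<^sup>2 \<partial>M) \<le> 0"
    using H_pos[of m] by (simp only: mult_le_cancel_right_pos)
  moreover have nn: "AE \<omega> in M. 0 \<le> h \<omega> ^ m * (h \<omega> - c)\<^sup>2"
    using hb by eventually_elim auto
  ultimately have "(\<integral>\<omega>. h \<omega> ^ m * (h \<omega> - c)\<^sup>2 \<partial>M) = 0"
    using integral_nonneg_AE[OF nn] by simp
  then have "AE \<omega> in M. h \<omega> ^ m * (h \<omega> - c)\<^sup>2 = 0"
    using integral_nonneg_eq_0_iff_AE[OF int nn] by simp
  \<comment> \<open>The weight \<open>h ^ m\<close> is positive and can be cancelled;
    \<open>h = c\<close> then fixes \<open>p\<close>.\<close>
  then have pc: "AE \<omega> in M. p \<omega> = 2 - 2 * c"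
    using h_bounds by eventually_elim (auto simp: h_def)
  define q where "q = 2 - 2 * c"
  have "AE \<omega> in M. 0 \<le> q \<and> q \<le> 1"
    using pc p_bounds by eventually_elim (auto simp: q_def)
  then have "0 \<le> q" "q \<le> 1" by auto
  moreover have "q \<noteq> 0" "q \<noteq> 1"
    using pc not_zero not_one by (auto simp: q_def)
  moreover have "A k = [:1 - q, q:] ^ k" for k
  proof -
    have "poly (A k) s = poly ([:1 - q, q:] ^ k) s" for s
    proof -
      have "poly (A k) s = (\<integral>\<omega>. (1 - q + q * s) ^ k \<partial>M)"
        unfolding A_def poly_mix_poly
        by (rule integral_cong_AE) (use pc in \<open>auto elim!: eventually_mono simp: q_def\<close>)
      also have "\<dots> = poly ([:1 - q, q:] ^ k) s"
        by (simp add: prob_space poly_power algebra_simps)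
      finally show ?thesis .
    qed
    then show ?thesis by (simp add: poly_eq_poly_eq_iff[symmetric] fun_eq_iff)
  qed
  ultimately show ?thesis by (intro exI[of _ q]) auto
qed

lemma bernoulli_family: "bernoulli_family (mix_poly M p)"
proof
  show "0 \<le> coeff (mix_poly M p k) i" for k i
    by (simp add: coeff_mix_poly mom_nonneg)
  show "0 < coeff (mix_poly M p k) 0" for k
    using mom_power_pos(2)[of k] by (simp add: coeff_mix_poly)
qed (fact degree_mix_poly dichotomy_mix_poly rigid_mix_poly)+

end

section \<open>The conditional laws of the model\<close>

context prob_space
begin

text \<open>The expectation of a conditional probability is the unconditional one. The bounds on
  \<open>p\<close> enter because \<open>bernoulli_pmf\<close> has the expected masses only for
  parameters in the unit interval.\<close>

lemma prob_cond_iid_bernoulli: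
  assumes W: "cond_iid_bernoulli p W" and "finite I"
  shows "prob {\<omega> \<in> space M. \<forall>i\<in>I. W i \<omega> = of_bool (b i)} =
    (\<integral>\<omega>. (\<Prod>i\<in>I. if b i then p \<omega> else 1 - p \<omega>) \<partial>M)"
proof -
  have [measurable]: "random_variable borel p" "\<And>i. random_variable (count_space UNIV) (W i)"
    and p: "AE \<omega> in M. 0 \<le> p \<omega> \<and> p \<omega> \<le> 1"
    using W by (auto simp: cond_iid_bernoulli_def)
  let ?F = "vimage_algebra (space M) p borel"
  let ?D = "{\<omega> \<in> space M. \<forall>i\<in>I. W i \<omega> = of_bool (b i)}"
  have "subalgebra M ?F"
    using sets_image_in_sets[of M "space M" p borel] by (simp add: subalgebra_def)
  then interpret finite_measure_subalgebra M ?F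
    by unfold_locales
  have D: "?D \<in> events"
    using \<open>finite I\<close> by (intro sets.sets_Collect_finite_All) auto
  have "prob ?D = (\<integral>\<omega>. indicator ?D \<omega> \<partial>M)"
    using D by simp
  also have "\<dots> = (\<integral>\<omega>. real_cond_exp M ?F (indicator ?D) \<omega> \<partial>M)"
    by (rule real_cond_exp_int(2)[symmetric], rule integrable_real_indicator[OF D]) (simp flip: less_top)
  also have "\<dots> = (\<integral>\<omega>. (\<Prod>i\<in>I. if b i then p \<omega> else 1 - p \<omega>) \<partial>M)"
  proof (rule integral_cong_AE)
    have "AE \<omega> in M. real_cond_exp M ?F (indicator ?D) \<omega> =
        (\<Prod>i\<in>I. pmf (bernoulli_pmf (p \<omega>)) (b i))"
      using W \<open>finite I\<close> by (auto simp: cond_iid_bernoulli_def)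
    with p show "AE \<omega> in M. real_cond_exp M ?F (indicator ?D) \<omega> =
        (\<Prod>i\<in>I. if b i then p \<omega> else 1 - p \<omega>)"
    proof eventually_elim
      case (elim \<omega>)
      have "pmf (bernoulli_pmf (p \<omega>)) (b i) = (if b i then p \<omega> else 1 - p \<omega>)" for i
        using elim by (cases "b i") simp_all
      then show ?case using elim by simp
    qed
    show "(\<lambda>\<omega>. \<Prod>i\<in>I. if b i then p \<omega> else 1 - p \<omega>) \<in> borel_measurable M"
      by (intro borel_measurable_prod) auto
  qed (rule borel_measurable_cond_exp2)
  finally show ?thesis .
qed

text \<open>The probabilities of the values 0 and 1 are the expectations of \<open>1 - p\<close> and
  \<open>p\<close>, which add up to 1.\<close>

lemma cond_iid_bernoulli_01:
  assumes W: "cond_iid_bernoulli p W"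
  shows "AE \<omega> in M. W i \<omega> = 0 \<or> W i \<omega> = 1"
proof -
  have [measurable]: "random_variable borel p" "random_variable (count_space UNIV) (W i)"
    and p: "AE \<omega> in M. 0 \<le> p \<omega> \<and> p \<omega> \<le> 1"
    using W by (auto simp: cond_iid_bernoulli_def)
  have int: "integrable M p"
    by (rule integrable_const_bound[where B = 1], use p in eventually_elim) auto
  have "prob {\<omega> \<in> space M. W i \<omega> = 0 \<or> W i \<omega> = 1} =
      prob {\<omega> \<in> space M. W i \<omega> = 0} + prob {\<omega> \<in> space M. W i \<omega> = 1}"
    by (subst finite_measure_Union[symmetric]) (auto intro!: arg_cong[where f = prob])
  also have "\<dots> = (\<integral>\<omega>. 1 - p \<omega> \<partial>M) + (\<integral>\<omega>. p \<omega> \<partial>M)"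
    using prob_cond_iid_bernoulli[OF W, of "{i}" "\<lambda>_. False"]
      prob_cond_iid_bernoulli[OF W, of "{i}" "\<lambda>_. True"] by simp
  also have "\<dots> = 1"
    using int by (simp add: prob_space)
  finally have "AE \<omega> in M. \<omega> \<in> {\<omega> \<in> space M. W i \<omega> = 0 \<or> W i \<omega> = 1}"
    by (subst (asm) prob_eq_1) auto
  then show ?thesis by eventually_elim auto
qed

lemma random_parameter_cond_iid_bernoulli:
  assumes W: "cond_iid_bernoulli p W" and nondeg: "\<not> (\<exists>c. AE \<omega> in M. W 0 \<omega> = c)"
  shows "random_parameter M p"
proof
  show [measurable]: "random_variable borel p" and p: "AE \<omega> in M. 0 \<le> p \<omega> \<and> p \<omega> \<le> 1"
    using W by (auto simp: cond_iid_bernoulli_def)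
  have [measurable]: "random_variable (count_space UNIV) (W 0)"
    using W by (auto simp: cond_iid_bernoulli_def)
  show "\<not> (AE \<omega> in M. p \<omega> = 0)"
  proof
    assume "AE \<omega> in M. p \<omega> = 0"
    then have "(\<integral>\<omega>. 1 - p \<omega> \<partial>M) = (\<integral>\<omega>. 1 \<partial>M)"
      by (intro integral_cong_AE) auto
    then have "prob {\<omega> \<in> space M. W 0 \<omega> = 0} = 1"
      using prob_cond_iid_bernoulli[OF W, of "{0}" "\<lambda>_. False"] by (simp add: prob_space)
    then have "AE \<omega> in M. \<omega> \<in> {\<omega> \<in> space M. W 0 \<omega> = 0}"
      by (subst (asm) prob_eq_1) auto
    then have "AE \<omega> in M. W 0 \<omega> = 0" by eventually_elim auto
    then show False using nondeg by blast
  qed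
  show "\<not> (AE \<omega> in M. p \<omega> = 1)"
  proof
    assume "AE \<omega> in M. p \<omega> = 1"
    then have "(\<integral>\<omega>. p \<omega> \<partial>M) = (\<integral>\<omega>. 1 \<partial>M)"
      by (intro integral_cong_AE) auto
    then have "prob {\<omega> \<in> space M. W 0 \<omega> = 1} = 1"
      using prob_cond_iid_bernoulli[OF W, of "{0}" "\<lambda>_. True"] by (simp add: prob_space)
    then have "AE \<omega> in M. \<omega> \<in> {\<omega> \<in> space M. W 0 \<omega> = 1}"
      by (subst (asm) prob_eq_1) auto
    then have "AE \<omega> in M. W 0 \<omega> = 1" by eventually_elim auto
    then show False using nondeg by blast
  qed
qed

lemma prob_sum_cond_iid_bernoulli:
  assumes W: "cond_iid_bernoulli p W"
  shows "prob {\<omega> \<in> space M. (\<Sum>i<n. W i \<omega>) = k} = coeff (mix_poly M p n) k"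
proof -
  have [measurable]: "\<And>i. random_variable (count_space UNIV) (W i)"
    using W by (auto simp: cond_iid_bernoulli_def)
  \<comment> \<open>In \<open>D S\<close> exactly the trials in \<open>S\<close> succeed among the
    first \<open>n\<close>. Up to a null set, \<open>k\<close> successes is the disjoint union of
    the \<open>D S\<close> with \<open>card S = k\<close>.\<close>
  define D where "D S = {\<omega> \<in> space M. \<forall>i\<in>{..<n}. W i \<omega> = of_bool (i \<in> S)}" for S
  have D_meas: "D S \<in> events" for S
    unfolding D_def by (intro sets.sets_Collect_finite_All) auto
  let ?\<S> = "{S. S \<subseteq> {..<n} \<and> card S = k}"
  have sum_D: "(\<Sum>i<n. W i \<omega>) = card S" if "S \<subseteq> {..<n}" "\<omega> \<in> D S" for S \<omega>
  proof -
    have "(\<Sum>i<n. W i \<omega>) = (\<Sum>i<n. of_bool (i \<in> S))"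
      by (rule sum.cong) (use that in \<open>auto simp: D_def\<close>)
    also have "\<dots> = card ({..<n} \<inter> S)" by (simp add: Int_def)
    finally show ?thesis using that by (simp add: Int_absorb1)
  qed
  have prob_D: "prob (D S) = (\<integral>\<omega>. p \<omega> ^ k * (1 - p \<omega>) ^ (n - k) \<partial>M)" if "S \<in> ?\<S>" for S
  proof -
    have "card ({..<n} - S) = n - k"
      using that by (auto simp: card_Diff_subset finite_subset)
    moreover have "{..<n} \<inter> S = S" "{..<n} \<inter> - S = {..<n} - S" using that by auto
    ultimately have "(\<Prod>i<n. if i \<in> S then p \<omega> else 1 - p \<omega>) = p \<omega> ^ k * (1 - p \<omega>) ^ (n - k)" for \<omega>
      using that by (simp add: prod.If_cases)
    then show ?thesis
      unfolding D_def by (subst prob_cond_iid_bernoulli[OF W]) simp_all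
  qed
  have "AE \<omega> in M. \<forall>i. W i \<omega> = 0 \<or> W i \<omega> = 1"
    using cond_iid_bernoulli_01[OF W] by (simp add: AE_all_countable)
  then have "AE \<omega> in M. \<omega> \<in> {\<omega> \<in> space M. (\<Sum>i<n. W i \<omega>) = k} \<longleftrightarrow> \<omega> \<in> (\<Union>S\<in>?\<S>. D S)"
    using AE_space
  proof eventually_elim
    case (elim \<omega>)
    let ?S = "{i. i < n \<and> W i \<omega> = 1}"
    have "W i \<omega> = of_bool (i \<in> ?S)" if "i < n" for i
      using elim(1)[rule_format, of i] that by auto
    then have \<omega>: "\<omega> \<in> D ?S"
      using elim(2) by (simp add: D_def)
    have sub: "?S \<subseteq> {..<n}" by auto
    have "\<omega> \<in> (\<Union>S\<in>?\<S>. D S)" if "(\<Sum>i<n. W i \<omega>) = k"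
      by (rule UN_I[where a = ?S]) (use \<omega> sub sum_D[OF sub \<omega>] that in simp_all)
    moreover have "(\<Sum>i<n. W i \<omega>) = k" if "\<omega> \<in> (\<Union>S\<in>?\<S>. D S)"
      using that sum_D by auto
    ultimately show ?case using elim(2) by auto
  qed
  then have "prob {\<omega> \<in> space M. (\<Sum>i<n. W i \<omega>) = k} = prob (\<Union>S\<in>?\<S>. D S)"
    by (rule finite_measure_eq_AE) (use D_meas in auto)
  also have "\<dots> = (\<Sum>S\<in>?\<S>. prob (D S))"
  proof (rule finite_measure_finite_Union)
    show "disjoint_family_on D ?\<S>"
    proof -
      have "S = {i. i < n \<and> W i \<omega> = 1}" if "S \<in> ?\<S>" "\<omega> \<in> D S" for S \<omega>
        using that by (auto simp: D_def of_bool_def split: if_splits)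
      then show ?thesis unfolding disjoint_family_on_def by blast
    qed
  qed (use D_meas in auto)
  also have "\<dots> = real (card ?\<S>) * (\<integral>\<omega>. p \<omega> ^ k * (1 - p \<omega>) ^ (n - k) \<partial>M)"
    using prob_D by simp
  also have "\<dots> = coeff (mix_poly M p n) k"
    by (simp add: coeff_mix_poly n_subsets)
  finally show ?thesis .
qed

section \<open>Independence and convolution\<close>

lemma indep_rvD:
  assumes "indep_rv N U N' V" "{x \<in> space N. P x} \<in> sets N" "{x \<in> space N'. Q x} \<in> sets N'"
  shows "prob {\<omega> \<in> space M. P (U \<omega>) \<and> Q (V \<omega>)} =
    prob {\<omega> \<in> space M. P (U \<omega>)} * prob {\<omega> \<in> space M. Q (V \<omega>)}"
proof -
  have rv: "random_variable N U" "random_variable N' V"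
    and ind: "indep_set (sets (vimage_algebra (space M) U N)) (sets (vimage_algebra (space M) V N'))"
    using assms by (auto simp: indep_rv_def)
  have eqs: "U -` {x \<in> space N. P x} \<inter> space M = {\<omega> \<in> space M. P (U \<omega>)}"
    "V -` {x \<in> space N'. Q x} \<inter> space M = {\<omega> \<in> space M. Q (V \<omega>)}"
    using rv by (auto dest: measurable_space)
  have "prob ({\<omega> \<in> space M. P (U \<omega>)} \<inter> {\<omega> \<in> space M. Q (V \<omega>)}) =
      prob {\<omega> \<in> space M. P (U \<omega>)} * prob {\<omega> \<in> space M. Q (V \<omega>)}"
    using in_vimage_algebra[OF assms(2), of U "space M"] in_vimage_algebra[OF assms(3), of V "space M"]
    unfolding eqs by (rule indep_setD[OF ind])
  moreover have "{\<omega> \<in> space M. P (U \<omega>)} \<inter> {\<omega> \<in> space M. Q (V \<omega>)} =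
      {\<omega> \<in> space M. P (U \<omega>) \<and> Q (V \<omega>)}" by auto
  ultimately show ?thesis by simp
qed

text \<open>\<open>Q\<close> is meant as the conditioning event and \<open>v\<close> as its
  probability; carrying both along avoids a conditional measure.\<close>

lemma prob_sum3_eq_fps_nth:
  fixes T1 T2 e :: "'a \<Rightarrow> nat"
  assumes [measurable]: "random_variable (count_space UNIV) T1"
      "random_variable (count_space UNIV) T2" "random_variable (count_space UNIV) e"
      "Measurable.pred M Q"
    and joint: "\<And>a b c. prob {\<omega> \<in> space M. (T1 \<omega> = a \<and> T2 \<omega> = b) \<and> e \<omega> = c \<and> Q \<omega>} =
      F $ a * G $ b * (E $ c * v)"
  shows "prob {\<omega> \<in> space M. T1 \<omega> + T2 \<omega> + e \<omega> = u \<and> Q \<omega>} = v * (E * F * G) $ u"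
proof -
  \<comment> \<open>\<open>i\<close> is the value of \<open>T1 + e\<close> and \<open>j\<close> that
    of \<open>e\<close>, matching the nested convolution \<open>(E * F) * G\<close>.\<close>
  let ?I = "SIGMA i:{0..u}. {0..i}"
  let ?D = "\<lambda>(i, j). {\<omega> \<in> space M. (T1 \<omega> = i - j \<and> T2 \<omega> = u - i) \<and> e \<omega> = j \<and> Q \<omega>}"
  have "{\<omega> \<in> space M. T1 \<omega> + T2 \<omega> + e \<omega> = u \<and> Q \<omega>} = (\<Union>ij\<in>?I. ?D ij)"
  proof (intro equalityI subsetI)
    fix \<omega> assume "\<omega> \<in> {\<omega> \<in> space M. T1 \<omega> + T2 \<omega> + e \<omega> = u \<and> Q \<omega>}"
    then have "(T1 \<omega> + e \<omega>, e \<omega>) \<in> ?I" "\<omega> \<in> ?D (T1 \<omega> + e \<omega>, e \<omega>)" by auto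
    then show "\<omega> \<in> (\<Union>ij\<in>?I. ?D ij)" by blast
  qed auto
  also have "prob (\<Union>ij\<in>?I. ?D ij) = (\<Sum>ij\<in>?I. prob (?D ij))"
    by (rule finite_measure_finite_Union) (auto simp: disjoint_family_on_def)
  also have "\<dots> = (\<Sum>i = 0..u. \<Sum>j = 0..i. F $ (i - j) * G $ (u - i) * (E $ j * v))"
    unfolding sum.Sigma[OF finite_atLeastAtMost ballI[OF finite_atLeastAtMost]]
    by (rule sum.cong[OF refl]) (simp only: case_prod_beta joint)
  also have "\<dots> = v * (E * F * G) $ u"
    unfolding fps_mult_nth[of "E * F"] fps_mult_nth[of E]
    by (simp only: sum_distrib_left sum_distrib_right ac_simps)
  finally show ?thesis .
qed

definition pgf :: "('a \<Rightarrow> nat) \<Rightarrow> real fps" where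
  "pgf e = Abs_fps (\<lambda>n. prob {\<omega> \<in> space M. e \<omega> = n})"

lemma pgf_nonneg: "0 \<le> pgf e $ n"
  by (simp add: pgf_def)

lemma pgf_nonzero:
  assumes [measurable]: "random_variable (count_space UNIV) e"
  shows "pgf e \<noteq> 0"
proof
  assume "pgf e = 0"
  then have "pgf e $ n = 0" for n by simp
  then have "prob {\<omega> \<in> space M. e \<omega> = n} = 0" for n
    by (simp add: pgf_def)
  then have "AE \<omega> in M. e \<omega> \<noteq> n" for n
    by (simp add: prob_eq_0)
  then have "AE \<omega> in M. \<forall>n. e \<omega> \<noteq> n"
    unfolding AE_all_countable by blast
  then have "AE \<omega> in M. False" by eventually_elim blast
  then show False by simp
qed

text \<open>Division-free form of a model equation, valid also at conditioning values of probability
  0, where both sides vanish.\<close>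

lemma rc_equation_fps:
  assumes eq: "rc_equation U V1 V2 A B e"
    and A: "cond_iid_bernoulli p A" and B: "cond_iid_bernoulli q B"
    and [measurable]: "random_variable (count_space UNIV) U" "random_variable (count_space UNIV) V1"
      "random_variable (count_space UNIV) V2"
  shows "random_variable (count_space UNIV) e"
    and "prob {\<omega> \<in> space M. U \<omega> = u \<and> V1 \<omega> = v1 \<and> V2 \<omega> = v2} =
      prob {\<omega> \<in> space M. V1 \<omega> = v1 \<and> V2 \<omega> = v2} *
      (pgf e * fps_of_poly (mix_poly M p v1) * fps_of_poly (mix_poly M q v2)) $ u"
proof -
  let ?S = "\<Pi>\<^sub>M i\<in>(UNIV :: nat set). count_space (UNIV :: nat set)"
  have AB: "indep_rv ?S (\<lambda>\<omega> i. A i \<omega>) ?S (\<lambda>\<omega> i. B i \<omega>)"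
    and ABe: "indep_rv (?S \<Otimes>\<^sub>M ?S) (\<lambda>\<omega>. (\<lambda>i. A i \<omega>, \<lambda>i. B i \<omega>))
                 (count_space UNIV) (\<lambda>\<omega>. (V1 \<omega>, V2 \<omega>, e \<omega>))"
    and eV: "indep_rv (count_space UNIV) e (count_space UNIV) (\<lambda>\<omega>. (V1 \<omega>, V2 \<omega>))"
    and cond: "\<P>(\<omega> in M. U \<omega> = u \<bar> V1 \<omega> = v1 \<and> V2 \<omega> = v2) =
        \<P>(\<omega> in M. (\<Sum>i<V1 \<omega>. A i \<omega>) + (\<Sum>i<V2 \<omega>. B i \<omega>) + e \<omega> = u
              \<bar> V1 \<omega> = v1 \<and> V2 \<omega> = v2)"
    using eq by (auto simp: rc_equation_def Let_def)
  show e [measurable]: "random_variable (count_space UNIV) e"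
    using eV by (simp add: indep_rv_def)
  have [measurable]: "random_variable (count_space UNIV) (A i)" "random_variable (count_space UNIV) (B i)" for i
    using A B by (auto simp: cond_iid_bernoulli_def)
  have sum_meas [measurable]: "(\<lambda>f. \<Sum>i<n. f i) \<in> ?S \<rightarrow>\<^sub>M count_space UNIV" for n
  proof (induction n)
    case 0
    show ?case by simp
  next
    case (Suc n)
    note [measurable] = this
    show ?case by simp
  qed
  let ?TA = "\<lambda>\<omega>. \<Sum>i<v1. A i \<omega>" and ?TB = "\<lambda>\<omega>. \<Sum>i<v2. B i \<omega>"
  let ?V = "\<lambda>\<omega>. V1 \<omega> = v1 \<and> V2 \<omega> = v2"
  let ?v = "prob {\<omega> \<in> space M. ?V \<omega>}"
  have rvA: "(\<lambda>\<omega> i. A i \<omega>) \<in> M \<rightarrow>\<^sub>M ?S" and rvB: "(\<lambda>\<omega> i. B i \<omega>) \<in> M \<rightarrow>\<^sub>M ?S"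
    using AB by (simp_all add: indep_rv_def)
  have [measurable]: "random_variable (count_space UNIV) ?TA" "random_variable (count_space UNIV) ?TB"
    using measurable_compose[OF rvA sum_meas] measurable_compose[OF rvB sum_meas] by simp_all
  have joint: "prob {\<omega> \<in> space M. (?TA \<omega> = a \<and> ?TB \<omega> = b) \<and> e \<omega> = c \<and> ?V \<omega>} =
      fps_of_poly (mix_poly M p v1) $ a * fps_of_poly (mix_poly M q v2) $ b * (pgf e $ c * ?v)" for a b c
  proof -
    have "prob {\<omega> \<in> space M. (?TA \<omega> = a \<and> ?TB \<omega> = b) \<and> e \<omega> = c \<and> ?V \<omega>} =
        prob {\<omega> \<in> space M. ?TA \<omega> = a \<and> ?TB \<omega> = b} * prob {\<omega> \<in> space M. e \<omega> = c \<and> ?V \<omega>}"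
      using indep_rvD[OF ABe, of "\<lambda>(f, g). (\<Sum>i<v1. f i) = a \<and> (\<Sum>i<v2. g i) = b"
          "\<lambda>(x, y, z). z = c \<and> x = v1 \<and> y = v2"]
      by simp
    also have "prob {\<omega> \<in> space M. ?TA \<omega> = a \<and> ?TB \<omega> = b} =
        prob {\<omega> \<in> space M. ?TA \<omega> = a} * prob {\<omega> \<in> space M. ?TB \<omega> = b}"
      using indep_rvD[OF AB, of "\<lambda>f. (\<Sum>i<v1. f i) = a" "\<lambda>f. (\<Sum>i<v2. f i) = b"] by simp
    also have "prob {\<omega> \<in> space M. e \<omega> = c \<and> ?V \<omega>} = prob {\<omega> \<in> space M. e \<omega> = c} * ?v"
      using indep_rvD[OF eV, of "\<lambda>x. x = c" "\<lambda>(x, y). x = v1 \<and> y = v2"] by simp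
    finally show ?thesis
      by (simp add: prob_sum_cond_iid_bernoulli[OF A] prob_sum_cond_iid_bernoulli[OF B] pgf_def)
  qed
  have "prob {\<omega> \<in> space M. U \<omega> = u \<and> ?V \<omega>} =
      prob {\<omega> \<in> space M. (\<Sum>i<V1 \<omega>. A i \<omega>) + (\<Sum>i<V2 \<omega>. B i \<omega>) + e \<omega> = u \<and> ?V \<omega>}"
  proof (cases "?v = 0")
    case True
    have "prob {\<omega> \<in> space M. R \<omega> \<and> ?V \<omega>} = 0" for R
    proof -
      have "prob {\<omega> \<in> space M. R \<omega> \<and> ?V \<omega>} \<le> ?v"
        by (rule finite_measure_mono) auto
      then show ?thesis using True by (simp add: measure_le_0_iff)
    qed
    then show ?thesis by simp
  next
    case False
    then show ?thesis using cond by (simp add: cond_prob_def)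
  qed
  also have "\<dots> = prob {\<omega> \<in> space M. ?TA \<omega> + ?TB \<omega> + e \<omega> = u \<and> ?V \<omega>}"
    by (rule arg_cong[where f = prob]) auto
  also have "\<dots> = ?v * (pgf e * fps_of_poly (mix_poly M p v1) * fps_of_poly (mix_poly M q v2)) $ u"
    by (rule prob_sum3_eq_fps_nth[OF _ _ _ _ joint]) measurable
  finally show "prob {\<omega> \<in> space M. U \<omega> = u \<and> ?V \<omega>} =
      ?v * (pgf e * fps_of_poly (mix_poly M p v1) * fps_of_poly (mix_poly M q v2)) $ u" .
qed

end

section \<open>Conditionals normalized at the smallest point of the support\<close>

declare One_nat_def [simp del]

lemma fps_mult_nth_cong:
  fixes f g h :: "'a :: comm_ring_1 fps"
  assumes "\<And>n. n \<le> l \<Longrightarrow> f $ n = g $ n"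
  shows "(f * h) $ l = (g * h) $ l"
  using assms by (simp add: fps_mult_nth)

lemma fps_mult_nth_first:
  fixes f g :: "'a :: comm_ring_1 fps"
  assumes "g $ 0 = 1" "0 < l" "\<And>n. 0 < n \<Longrightarrow> n < l \<Longrightarrow> g $ n = 0"
  shows "(f * g) $ l = f $ l + f $ 0 * g $ l"
proof -
  have "(f * g) $ l = (\<Sum>i\<in>{0, l}. f $ i * g $ (l - i))"
    unfolding fps_mult_nth by (rule sum.mono_neutral_right) (use assms in auto)
  then show ?thesis using assms by simp
qed

lemma fps_eq_poly_if_nth_eq_0:
  fixes f :: "'a :: comm_ring_1 fps"
  assumes "\<And>i. l < i \<Longrightarrow> f $ i = 0"
  obtains h where "f = fps_of_poly h" "degree h \<le> l"
proof
  show "f = fps_of_poly (\<Sum>i\<le>l. monom (f $ i) i)"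
    by (rule fps_ext) (auto simp: coeff_sum assms if_distrib cong: if_cong)
  show "degree (\<Sum>i\<le>l. monom (f $ i) i) \<le> l"
    by (rule degree_sum_le) (auto intro: order_trans[OF degree_monom_le])
qed

text \<open>\<open>A (m + j) / A m\<close> scaled to constant term 1: up to normalization, the
  factor gained by a conditional generating function when the conditioning variable rises from
  \<open>m\<close> to \<open>m + j\<close>.\<close>

definition ratio :: "(nat \<Rightarrow> real poly) \<Rightarrow> nat \<Rightarrow> nat \<Rightarrow> real fps" where
  "ratio A m j = fps_const (coeff (A m) 0 / coeff (A (m + j)) 0) * fps_of_poly (A (m + j)) *
     inverse (fps_of_poly (A m))"

context bernoulli_family
begin

definition norm_const :: "nat \<Rightarrow> nat \<Rightarrow> real" where
  "norm_const m j = coeff (A m) 0 / coeff (A (m + j)) 0"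

lemma norm_const_pos: "0 < norm_const m j"
  by (simp add: norm_const_def coeff_0_pos)

lemma ratio_0 [simp]: "ratio A m 0 = 1"
  using coeff_0_pos[of m] by (simp add: ratio_def inverse_mult_eq_1')

lemma ratio_nth_0 [simp]: "ratio A m j $ 0 = 1"
  using coeff_0_pos[of m] coeff_0_pos[of "m + j"] by (simp add: ratio_def)

lemma ratio_mult:
  "ratio A m j * fps_of_poly (A m) = fps_of_poly (smult (norm_const m j) (A (m + j)))"
  using coeff_0_pos[of m]
  by (simp add: ratio_def norm_const_def fps_of_poly_smult mult.assoc inverse_mult_eq_1)

end

text \<open>Clearing denominators leaves a polynomial identity between degrees
  \<open>m + j + n\<close> and \<open>n + k + m\<close>.\<close>

lemma ratio_eq_imp_index_eq:
  assumes "bernoulli_family A" "bernoulli_family B" and eq: "ratio A m j = ratio B n k"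
  shows "j = k"
proof -
  interpret A: bernoulli_family A by fact
  interpret B: bernoulli_family B by fact
  have "ratio A m j * fps_of_poly (A m) * fps_of_poly (B n) =
      ratio B n k * fps_of_poly (B n) * fps_of_poly (A m)"
    by (simp add: eq ac_simps)
  then have "smult (A.norm_const m j) (A (m + j)) * B n =
      smult (B.norm_const n k) (B (n + k)) * A m"
    unfolding A.ratio_mult B.ratio_mult by (simp flip: fps_of_poly_mult)
  then have "degree (smult (A.norm_const m j) (A (m + j)) * B n) =
      degree (smult (B.norm_const n k) (B (n + k)) * A m)"
    by simp
  then show ?thesis
    using A.norm_const_pos[of m j] B.norm_const_pos[of n k] by (simp add: degree_mult_eq)
qed

text \<open>Here \<open>\<pi> i j k\<close> stands for the probability of \<open>(m1 + i, m2 + j, m3 + k)\<close>, where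
  \<open>(m1, m2, m3)\<close> is the smallest point of the support.\<close>
locale normalized_conditionals =
  fixes \<pi> :: "nat \<Rightarrow> nat \<Rightarrow> nat \<Rightarrow> real"
    and E1 E2 E3 :: "real fps"
    and A1 A2 A3 A4 A5 A6 :: "nat \<Rightarrow> real poly"
    and m1 m2 m3 :: nat
  assumes fam1: "bernoulli_family A1" and fam2: "bernoulli_family A2"
    and fam3: "bernoulli_family A3" and fam4: "bernoulli_family A4"
    and fam5: "bernoulli_family A5" and fam6: "bernoulli_family A6"
    and E_0: "E1 $ 0 = 1" "E2 $ 0 = 1" "E3 $ 0 = 1"
    and eq1: "\<pi> i j k = \<pi> 0 j k * (E1 * ratio A1 m2 j * ratio A2 m3 k) $ i"
    and eq2: "\<pi> i j k = \<pi> i 0 k * (E2 * ratio A3 m1 i * ratio A4 m3 k) $ j"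
    and eq3: "\<pi> i j k = \<pi> i j 0 * (E3 * ratio A5 m1 i * ratio A6 m2 j) $ k"
    and origin: "\<pi> 0 0 0 \<noteq> 0"
begin

sublocale A1: bernoulli_family A1 by (fact fam1)
sublocale A2: bernoulli_family A2 by (fact fam2)
sublocale A3: bernoulli_family A3 by (fact fam3)
sublocale A4: bernoulli_family A4 by (fact fam4)
sublocale A5: bernoulli_family A5 by (fact fam5)
sublocale A6: bernoulli_family A6 by (fact fam6)

text \<open>Together with \<open>swap_XY\<close> this generates all relabellings of the variables,
  so each later fact is proved in one orientation only.\<close>

lemma swap_YZ:
  "normalized_conditionals (\<lambda>i j k. \<pi> i k j) E1 E3 E2 A2 A1 A5 A6 A3 A4 m1 m3 m2"
proof
  show "\<pi> i k j = \<pi> 0 k j * (E1 * ratio A2 m3 j * ratio A1 m2 k) $ i" for i j k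
    by (subst eq1) (simp add: ac_simps)
qed (fact fam1 fam2 fam3 fam4 fam5 fam6 E_0 eq2 eq3 origin)+

lemma swap_XY:
  "normalized_conditionals (\<lambda>i j k. \<pi> j i k) E2 E1 E3 A3 A4 A1 A2 A6 A5 m2 m1 m3"
proof
  show "\<pi> j i k = \<pi> j i 0 * (E3 * ratio A6 m2 i * ratio A5 m1 j) $ k" for i j k
    by (subst eq3) (simp add: ac_simps)
qed (fact fam1 fam2 fam3 fam4 fam5 fam6 E_0 eq1 eq2 origin)+

lemma E1_nonzero: "E1 \<noteq> 0"
  using E_0(1) by auto

text \<open>If \<open>p\<^sub>3\<close> is \<open>{0,1}\<close>-valued, the law of \<open>Y\<close> at a fixed level \<open>l\<close> no longer depends on
  \<open>X = i\<close> once \<open>i > l\<close>. The conditional generating functions of \<open>X\<close> for \<open>Y = l\<close> and \<open>Y = 0\<close>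
  are then proportional up to a polynomial of degree at most \<open>l\<close>, for every value \<open>k\<close> of \<open>Z\<close>,
  while their degrees as rational functions grow with \<open>k\<close>.\<close>
lemma not_two_valued:
  assumes two: "\<And>k i. 0 < i \<Longrightarrow> i < k \<Longrightarrow> coeff (A3 k) i = 0"
    and pos: "\<pi> 0 l 0 \<noteq> 0" "\<pi> 0 l k \<noteq> 0" and l: "0 < l" and k: "l < k"
  shows False
proof -
  \<comment> \<open>\<open>ratio A3 m1 i\<close> splits into \<open>J\<close>, free of
    \<open>i\<close>, and a rescaled numerator \<open>N\<close> that agrees with 1 up to order
    \<open>l\<close> when \<open>i > l\<close>. Hence \<open>c n\<close> does not depend on
    \<open>i\<close>.\<close>
  define J where "J = fps_const (coeff (A3 m1) 0) * inverse (fps_of_poly (A3 m1))"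
  define c where "c n = (E2 * J * ratio A4 m3 n) $ l" for n
  have c: "(E2 * ratio A3 m1 i * ratio A4 m3 n) $ l = c n" if "l < i" for i n
  proof -
    define N where "N = fps_const (1 / coeff (A3 (m1 + i)) 0) * fps_of_poly (A3 (m1 + i))"
    have const: "fps_const (x / y) = fps_const (1 / y) * fps_const x" for x y :: real
      by simp
    have "ratio A3 m1 i = N * J"
      unfolding ratio_def N_def J_def const[of "coeff (A3 m1) 0"] by (simp only: ac_simps)
    then have eq: "E2 * ratio A3 m1 i * ratio A4 m3 n = N * (E2 * J * ratio A4 m3 n)"
      by (simp add: ac_simps)
    have "(N * (E2 * J * ratio A4 m3 n)) $ l = (1 * (E2 * J * ratio A4 m3 n)) $ l"
      by (rule fps_mult_nth_cong)
         (use two[of _ "m1 + i"] that A3.coeff_0_pos[of "m1 + i"] in \<open>auto simp: N_def\<close>)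
    then show ?thesis unfolding eq c_def by simp
  qed
  define G where "G n = smult (\<pi> 0 l n * A1.norm_const m2 l) (A1 (m2 + l)) -
    smult (c n * \<pi> 0 0 n) (A1 m2)" for n
  have deg_G: "degree (G n) = m2 + l" if "\<pi> 0 l n \<noteq> 0" for n
  proof -
    have "degree (- smult (c n * \<pi> 0 0 n) (A1 m2)) <
        degree (smult (\<pi> 0 l n * A1.norm_const m2 l) (A1 (m2 + l)))"
      using that l A1.norm_const_pos[of m2 l] by simp
    from degree_add_eq_left[OF this] show ?thesis
      using that A1.norm_const_pos[of m2 l] by (simp add: G_def)
  qed
  have "\<exists>h. degree h \<le> l \<and>
      fps_of_poly h * fps_of_poly (A2 m3) * fps_of_poly (A1 m2) =
      E1 * fps_of_poly (smult (A2.norm_const m3 n) (A2 (m3 + n))) * fps_of_poly (G n)" for n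
  proof -
    define f where "f = fps_const (\<pi> 0 l n) * (E1 * ratio A1 m2 l * ratio A2 m3 n) -
      fps_const (c n * \<pi> 0 0 n) * (E1 * ratio A2 m3 n)"
    have "f $ i = 0" if "l < i" for i
    proof -
      have "f $ i = \<pi> i l n - c n * \<pi> i 0 n"
        by (simp add: f_def eq1[of i l n] eq1[of i 0 n])
      then show ?thesis
        by (simp add: eq2[of i l n] c[OF that])
    qed
    then obtain h where h: "f = fps_of_poly h" "degree h \<le> l"
      by (rule fps_eq_poly_if_nth_eq_0) auto
    have "f * fps_of_poly (A2 m3) * fps_of_poly (A1 m2) =
        E1 * (ratio A2 m3 n * fps_of_poly (A2 m3)) *
          (fps_const (\<pi> 0 l n) * (ratio A1 m2 l * fps_of_poly (A1 m2)) -
           fps_const (c n * \<pi> 0 0 n) * fps_of_poly (A1 m2))"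
      by (simp add: f_def algebra_simps)
    also have "\<dots> = E1 * fps_of_poly (smult (A2.norm_const m3 n) (A2 (m3 + n))) * fps_of_poly (G n)"
      unfolding A1.ratio_mult A2.ratio_mult
      by (simp add: G_def fps_of_poly_diff flip: fps_of_poly_smult)
    finally show ?thesis using h by auto
  qed
  then obtain h where deg_h: "\<And>n. degree (h n) \<le> l"
    and h: "\<And>n. fps_of_poly (h n) * fps_of_poly (A2 m3) * fps_of_poly (A1 m2) =
      E1 * fps_of_poly (smult (A2.norm_const m3 n) (A2 (m3 + n))) * fps_of_poly (G n)"
    by metis
  have G_nonzero: "G 0 \<noteq> 0" "G k \<noteq> 0"
    using deg_G pos l by fastforce+
  have "fps_of_poly (h 0) * fps_of_poly (A2 m3) * fps_of_poly (A1 m2) \<noteq> 0"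
    unfolding h using E1_nonzero G_nonzero A2.norm_const_pos[of m3 0] by simp
  then have h_0: "h 0 \<noteq> 0" by auto
  define B where "B n = smult (A2.norm_const m3 n) (A2 (m3 + n))" for n
  \<comment> \<open>Cross-multiplying the identities for \<open>n = 0\<close> and
    \<open>n = k\<close> eliminates the unknown series \<open>E1\<close>.\<close>
  have "fps_of_poly (h k) * fps_of_poly (A2 m3) * fps_of_poly (A1 m2) *
        (fps_of_poly (B 0) * fps_of_poly (G 0)) =
      fps_of_poly (h 0) * fps_of_poly (A2 m3) * fps_of_poly (A1 m2) *
        (fps_of_poly (B k) * fps_of_poly (G k))"
    unfolding h B_def by (simp only: ac_simps)
  then have eq: "h k * A2 m3 * A1 m2 * (B 0 * G 0) = h 0 * A2 m3 * A1 m2 * (B k * G k)" (is "?P = ?Q")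
    by (simp flip: fps_of_poly_mult)
  have "?Q \<noteq> 0"
    using h_0 G_nonzero A2.norm_const_pos[of m3 k] by (simp add: B_def)
  then have "?P \<noteq> 0" unfolding eq .
  have "degree ?P = degree ?Q" by (simp only: eq)
  then have "degree (h k) + m3 + m2 + (m3 + degree (G 0)) =
      degree (h 0) + m3 + m2 + (m3 + k + degree (G k))"
    using \<open>?P \<noteq> 0\<close> \<open>?Q \<noteq> 0\<close>
    by (simp add: degree_mult_eq B_def)
  \<comment> \<open>\<open>G 0\<close> and \<open>G k\<close> have equal degree, so
    \<open>degree (h k) = degree (h 0) + k\<close>, which exceeds the bound
    \<open>l\<close>.\<close>
  then show False
    using deg_G pos deg_h[of k] k by simp
qed

text \<open>At first order a product of series with constant term 1 is additive, which separates the
  influences of \<open>X\<close> and \<open>Z\<close> on \<open>Y\<close>.\<close>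

lemma level_1_Y:
  "\<pi> i 1 k = \<pi> i 0 k * ((E2 * ratio A3 m1 i) $ 1 + ratio A4 m3 k $ 1)"
  by (subst eq2, subst fps_mult_nth_first) (auto simp: E_0)

text \<open>\<open>\<pi> i 1 K\<close> is evaluated via \<open>Y\<close> and via \<open>Z\<close>, where \<open>K\<close> is the first level at which the
  step from \<open>Y = 0\<close> to \<open>Y = 1\<close> is felt by \<open>Z\<close>. This identifies two conditional generating
  functions of \<open>X\<close>, and their degrees force \<open>K = 1\<close>.\<close>
lemma first_level:
  assumes pos: "\<pi> 0 1 0 \<noteq> 0"
  shows "ratio A2 m3 1 = ratio A1 m2 1"
    and "ratio A6 m2 1 $ 1 \<noteq> 0"
    and "\<pi> 0 0 1 * ratio A4 m3 1 $ 1 = \<pi> 0 1 0 * ratio A6 m2 1 $ 1"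
proof -
  define K where "K = (LEAST K. 0 < K \<and> ratio A6 m2 1 $ K \<noteq> 0)"
  \<comment> \<open>Otherwise \<open>ratio A6 m2 1\<close> would be the constant 1, that is
    \<open>ratio A6 m2 0\<close>, with a different index.\<close>
  have "\<exists>K. 0 < K \<and> ratio A6 m2 1 $ K \<noteq> 0"
  proof (rule ccontr)
    assume "\<not> ?thesis"
    then have "ratio A6 m2 1 $ n = 0" if "0 < n" for n
      using that by blast
    then have "ratio A6 m2 1 $ n = ratio A6 m2 0 $ n" for n
      by (cases "n = 0") simp_all
    then have "ratio A6 m2 1 = ratio A6 m2 0"
      by (rule fps_ext)
    then show False
      using ratio_eq_imp_index_eq[OF fam6 fam6] by fastforce
  qed
  then have K: "0 < K" "ratio A6 m2 1 $ K \<noteq> 0"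
    unfolding K_def by (metis (mono_tags, lifting) LeastI_ex)+
  have below: "ratio A6 m2 1 $ n = 0" if "0 < n" "n < K" for n
    using not_less_Least[of n "\<lambda>K. 0 < K \<and> ratio A6 m2 1 $ K \<noteq> 0"] that
    by (auto simp: K_def)
  \<comment> \<open>Both evaluations of \<open>\<pi> i 1 K\<close> contain \<open>\<pi> i 0 0 * (E2
    * ratio A3 m1 i) $ 1 * (E3 * ratio A5 m1 i) $ K\<close>. Once this cancels, \<open>i\<close>
    enters only through \<open>\<pi> i 0 K\<close> and \<open>\<pi> i 1 0\<close>.\<close>
  have shift: "\<pi> i 0 K * ratio A4 m3 K $ 1 = \<pi> i 1 0 * ratio A6 m2 1 $ K" for i
  proof -
    have "\<pi> i 1 K = \<pi> i 1 0 * ((E3 * ratio A5 m1 i) $ K + ratio A6 m2 1 $ K)"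
      by (subst eq3, subst fps_mult_nth_first) (use K below in \<open>auto simp: E_0\<close>)
    moreover have "\<pi> i 0 K = \<pi> i 0 0 * (E3 * ratio A5 m1 i) $ K"
      by (subst eq3) simp
    moreover have "\<pi> i 1 0 = \<pi> i 0 0 * (E2 * ratio A3 m1 i) $ 1"
      by (subst eq2) simp
    ultimately show ?thesis
      using level_1_Y[of i K] by (simp add: algebra_simps)
  qed
  have "fps_const (\<pi> 0 0 K * ratio A4 m3 K $ 1) * (E1 * ratio A2 m3 K) =
      fps_const (\<pi> 0 1 0 * ratio A6 m2 1 $ K) * (E1 * ratio A1 m2 1)"
  proof (rule fps_ext)
    fix i
    show "(fps_const (\<pi> 0 0 K * ratio A4 m3 K $ 1) * (E1 * ratio A2 m3 K)) $ i =
        (fps_const (\<pi> 0 1 0 * ratio A6 m2 1 $ K) * (E1 * ratio A1 m2 1)) $ i"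
      unfolding fps_mult_left_const_nth
      using shift[of i] eq1[of i 0 K] eq1[of i 1 0] by (simp add: algebra_simps)
  qed
  then have "ratio A2 m3 K = ratio A1 m2 1"
    using shift[of 0] pos K E1_nonzero by simp
  moreover from this have "K = 1"
    by (rule ratio_eq_imp_index_eq[OF fam2 fam1])
  ultimately show "ratio A2 m3 1 = ratio A1 m2 1" "ratio A6 m2 1 $ 1 \<noteq> 0"
      "\<pi> 0 0 1 * ratio A4 m3 1 $ 1 = \<pi> 0 1 0 * ratio A6 m2 1 $ 1"
    using K shift[of 0] by simp_all
qed

text \<open>Second-order analogue of \<open>first_level\<close>: \<open>\<pi> i 1 2\<close> is
  evaluated via \<open>Y\<close> and via \<open>Z\<close>. As raising \<open>Y\<close> acts on
  \<open>X\<close> like raising \<open>Z\<close>, the relation involves \<open>A2\<close> alone and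
  has the form required by \<open>rigid\<close>.\<close>

lemma constant_parameter_A2:
  assumes pos: "\<pi> 0 1 0 \<noteq> 0" "\<pi> 0 1 1 \<noteq> 0"
  shows "\<exists>q. 0 < q \<and> q < 1 \<and> (\<forall>k. A2 k = [:1 - q, q:] ^ k)"
proof -
  \<comment> \<open>\<open>\<delta>\<close> subtracts \<open>\<gamma>\<^sup>2\<close> because
    \<open>\<pi> i 1 1 * \<gamma>\<close> already contains that multiple of
    \<open>\<pi> i 1 0\<close>.\<close>
  define \<gamma> \<delta> w where "\<gamma> = ratio A6 m2 1 $ 1" and "\<delta> = ratio A6 m2 1 $ 2 - \<gamma>\<^sup>2"
    and "w = ratio A4 m3 2 $ 1"
  have level_2: "\<pi> i 0 2 * w = \<pi> i 1 1 * \<gamma> + \<pi> i 1 0 * \<delta>" for i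
  proof -
    have "\<pi> i 1 2 = \<pi> i 1 0 *
        ((E3 * ratio A5 m1 i) $ 2 + (E3 * ratio A5 m1 i) $ 1 * \<gamma> + ratio A6 m2 1 $ 2)"
      by (subst eq3, subst fps_mult_nth) (simp add: numeral_2_eq_2 One_nat_def \<gamma>_def E_0)
    moreover have "\<pi> i 1 1 = \<pi> i 1 0 * ((E3 * ratio A5 m1 i) $ 1 + \<gamma>)"
      by (subst eq3, subst fps_mult_nth_first) (auto simp: E_0 \<gamma>_def)
    moreover have "\<pi> i 0 2 = \<pi> i 0 0 * (E3 * ratio A5 m1 i) $ 2"
      by (subst eq3) simp
    moreover have "\<pi> i 1 0 = \<pi> i 0 0 * (E2 * ratio A3 m1 i) $ 1"
      by (subst eq2) simp
    ultimately show ?thesis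
      using level_1_Y[of i 2] by (simp add: w_def \<delta>_def power2_eq_square algebra_simps)
  qed
  define a b d where "a = \<pi> 0 0 2 * w" and "b = \<pi> 0 1 1 * \<gamma>" and "d = \<pi> 0 1 0 * \<delta>"
  have "b \<noteq> 0" using pos first_level(2) by (simp add: b_def \<gamma>_def)
  let ?\<rho> = "ratio A2 m3 1"
  have "E1 * (fps_const a * ratio A2 m3 2) = E1 * (fps_const b * ?\<rho>\<^sup>2 + fps_const d * ?\<rho>)"
  proof (rule fps_ext)
    fix i
    have "\<pi> i 0 2 = \<pi> 0 0 2 * (E1 * ratio A2 m3 2) $ i" by (subst eq1) simp
    moreover have "\<pi> i 1 1 = \<pi> 0 1 1 * (E1 * ?\<rho>\<^sup>2) $ i"
      by (subst eq1) (simp add: first_level(1)[OF pos(1)] power2_eq_square ac_simps)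
    moreover have "\<pi> i 1 0 = \<pi> 0 1 0 * (E1 * ?\<rho>) $ i"
      by (subst eq1) (simp add: first_level(1)[OF pos(1)])
    moreover have "(E1 * (fps_const a * ratio A2 m3 2)) $ i = a * (E1 * ratio A2 m3 2) $ i"
      by (simp only: mult.left_commute[of E1 "fps_const a"] fps_mult_left_const_nth)
    moreover have "(E1 * (fps_const b * ?\<rho>\<^sup>2 + fps_const d * ?\<rho>)) $ i =
        b * (E1 * ?\<rho>\<^sup>2) $ i + d * (E1 * ?\<rho>) $ i"
      by (simp only: distrib_left mult.left_commute[of E1 "fps_const b"]
          mult.left_commute[of E1 "fps_const d"] fps_add_nth fps_mult_left_const_nth)
    ultimately show "(E1 * (fps_const a * ratio A2 m3 2)) $ i =
        (E1 * (fps_const b * ?\<rho>\<^sup>2 + fps_const d * ?\<rho>)) $ i"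
      using level_2[of i] by (simp add: a_def b_def d_def algebra_simps)
  qed
  then have "fps_const a * ratio A2 m3 2 = fps_const b * ?\<rho>\<^sup>2 + fps_const d * ?\<rho>"
    using E1_nonzero by simp
  then have eq: "fps_const a * ratio A2 m3 2 * fps_of_poly (A2 m3) ^ 2 =
      (fps_const b * ?\<rho>\<^sup>2 + fps_const d * ?\<rho>) * fps_of_poly (A2 m3) ^ 2"
    by simp
  have "fps_const a * (ratio A2 m3 2 * fps_of_poly (A2 m3)) * fps_of_poly (A2 m3) =
      fps_const a * ratio A2 m3 2 * fps_of_poly (A2 m3) ^ 2"
    by (simp only: power2_eq_square ac_simps)
  also have "\<dots> = fps_const b * (?\<rho> * fps_of_poly (A2 m3))\<^sup>2 +
      fps_const d * (?\<rho> * fps_of_poly (A2 m3)) * fps_of_poly (A2 m3)"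
    unfolding eq by (simp only: power2_eq_square distrib_left distrib_right ac_simps)
  finally have "fps_of_poly (smult (a * A2.norm_const m3 2) (A2 m3 * A2 (m3 + 2))) =
      fps_of_poly (smult (b * (A2.norm_const m3 1)\<^sup>2) (A2 (m3 + 1) ^ 2) +
        smult (d * A2.norm_const m3 1) (A2 (m3 + 1) * A2 m3))"
    unfolding A2.ratio_mult
    by (simp add: fps_of_poly_smult fps_of_poly_mult fps_of_poly_add fps_of_poly_power
        power_mult_distrib ac_simps flip: fps_const_mult fps_const_power)
  then have rel: "smult (a * A2.norm_const m3 2) (A2 m3 * A2 (m3 + 2)) =
      smult (b * (A2.norm_const m3 1)\<^sup>2) (A2 (m3 + 1) ^ 2) +
        smult (d * A2.norm_const m3 1) (A2 (m3 + 1) * A2 m3)"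
    by (simp only: fps_of_poly_eq_iff)
  \<comment> \<open>Otherwise a polynomial of degree \<open>2 * m3 + 2\<close> would equal one of
    degree at most \<open>2 * m3 + 1\<close>.\<close>
  have "a \<noteq> 0"
  proof
    assume "a = 0"
    then have "smult (b * (A2.norm_const m3 1)\<^sup>2) (A2 (m3 + 1) ^ 2) =
        smult (- d * A2.norm_const m3 1) (A2 (m3 + 1) * A2 m3)"
      using rel by (simp add: add_eq_0_iff)
    then have "degree (smult (b * (A2.norm_const m3 1)\<^sup>2) (A2 (m3 + 1) ^ 2)) \<le>
        degree (A2 (m3 + 1) * A2 m3)"
      using degree_smult_le by metis
    then show False
      using \<open>b \<noteq> 0\<close> A2.norm_const_pos[of m3 1] by (simp add: degree_mult_eq degree_power_eq)
  qed
  then have "a * A2.norm_const m3 2 \<noteq> 0" using A2.norm_const_pos[of m3 2] by simp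
  then have "A2 m3 * A2 (m3 + 2) =
      smult (1 / (a * A2.norm_const m3 2)) (smult (a * A2.norm_const m3 2) (A2 m3 * A2 (m3 + 2)))"
    by simp
  also have "\<dots> = smult (b * (A2.norm_const m3 1)\<^sup>2 / (a * A2.norm_const m3 2)) (A2 (m3 + 1) ^ 2) +
      smult (d * A2.norm_const m3 1 / (a * A2.norm_const m3 2)) (A2 (m3 + 1) * A2 m3)"
    unfolding rel smult_add_right smult_smult by simp
  finally show ?thesis
    by (rule A2.rigid)
qed

end

section \<open>Constant parameters\<close>

lemma one_plus_X_power_nth:
  fixes c :: real
  shows "((1 + fps_const c * fps_X) ^ n) $ k = of_nat (n choose k) * c ^ k"
proof (induction n arbitrary: k)
  case 0
  show ?case by (cases k) auto
next
  case (Suc n)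
  show ?case
    by (cases k) (simp_all add: Suc distrib_right mult.assoc ring_distribs)
qed

text \<open>\<open>A k\<close> is a scalar multiple of the \<open>k\<close>-th power of a linear
  series whose slope is the odds \<open>q / (1 - q)\<close>, so the quotient no longer depends on
  \<open>m\<close>.\<close>

lemma ratio_binomial:
  assumes A: "\<And>k. A k = [:1 - q, q:] ^ k" and q: "0 < q" "q < 1"
  shows "ratio A m j = (1 + fps_const (q / (1 - q)) * fps_X) ^ j"
proof -
  let ?L = "1 + fps_const (q / (1 - q)) * fps_X"
  have coeff_0: "coeff (A k) 0 = (1 - q) ^ k" for k
    by (simp add: A coeff_0_power)
  have fps: "fps_of_poly (A k) = fps_const ((1 - q) ^ k) * ?L ^ k" for k
  proof -
    have "fps_of_poly [:1 - q, q:] = fps_const (1 - q) * ?L"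
      using q by (simp add: fps_of_poly_pCons distrib_left mult.assoc[symmetric] add.commute)
    then show ?thesis
      unfolding A fps_of_poly_power by (simp only: power_mult_distrib fps_const_power)
  qed
  have "inverse ((?L :: real fps) ^ m) * ?L ^ m = 1"
    by (rule inverse_mult_eq_1) simp
  moreover have "fps_const ((1 - q) ^ k) * inverse (fps_const ((1 - q) ^ k)) = 1" for k
    using q by (intro inverse_mult_eq_1') simp
  ultimately show ?thesis
    using q unfolding ratio_def coeff_0 fps
    by (simp add: fps_inverse_mult power_add field_simps fps_const_inverse)
qed

context normalized_conditionals
begin

text \<open>All ratios used become powers of linear series. Evaluating \<open>\<pi> 2 1 0\<close>
  and \<open>\<pi> 2 1 1\<close> in two ways each gives \<open>I1\<close> and \<open>I2\<close>;
  since \<open>first_level\<close> makes the odds proportional to the first coefficients of the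
  \<open>E\<close> series, these force \<open>2 * c ^ 3 * e1\<^sup>2 = 0\<close>.\<close>

lemma inconsistent:
  assumes pos: "\<pi> 1 0 0 \<noteq> 0" "\<pi> 0 1 0 \<noteq> 0" "\<pi> 0 0 1 \<noteq> 0"
      "\<pi> 0 1 1 \<noteq> 0" "\<pi> 1 0 1 \<noteq> 0" "\<pi> 1 1 0 \<noteq> 0"
  shows False
proof -
  interpret yz: normalized_conditionals "\<lambda>i j k. \<pi> i k j" E1 E3 E2 A2 A1 A5 A6 A3 A4 m1 m3 m2
    by (fact swap_YZ)
  interpret xy: normalized_conditionals "\<lambda>i j k. \<pi> j i k" E2 E1 E3 A3 A4 A1 A2 A6 A5 m2 m1 m3
    by (fact swap_XY)
  interpret zy: normalized_conditionals "\<lambda>i j k. \<pi> k i j" E2 E3 E1 A4 A3 A6 A5 A1 A2 m2 m3 m1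
    by (fact xy.swap_YZ)
  interpret zx: normalized_conditionals "\<lambda>i j k. \<pi> j k i" E3 E1 E2 A5 A6 A2 A1 A4 A3 m3 m1 m2
    by (fact yz.swap_XY)
  obtain q1 where q1: "\<And>k. A1 k = [:1 - q1, q1:] ^ k" "0 < q1" "q1 < 1"
    using yz.constant_parameter_A2 pos by auto
  obtain q2 where q2: "\<And>k. A2 k = [:1 - q2, q2:] ^ k" "0 < q2" "q2 < 1"
    using constant_parameter_A2 pos by auto
  obtain q3 where q3: "\<And>k. A3 k = [:1 - q3, q3:] ^ k" "0 < q3" "q3 < 1"
    using zy.constant_parameter_A2 pos by auto
  obtain q4 where q4: "\<And>k. A4 k = [:1 - q4, q4:] ^ k" "0 < q4" "q4 < 1"
    using xy.constant_parameter_A2 pos by auto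
  obtain q6 where q6: "\<And>k. A6 k = [:1 - q6, q6:] ^ k" "0 < q6" "q6 < 1"
    using zx.constant_parameter_A2 pos by auto
  define a b d where "a = q2 / (1 - q2)" and "b = q4 / (1 - q4)" and "d = q6 / (1 - q6)"
  let ?L = "\<lambda>c. 1 + fps_const c * fps_X :: real fps"
  have L_nth_1: "?L c $ 1 = c" for c by simp
  note r1 = ratio_binomial[OF q1] and r3 = ratio_binomial[OF q3]
  have r2: "ratio A2 m3 j = ?L a ^ j" for j unfolding a_def by (rule ratio_binomial[OF q2])
  have r4: "ratio A4 m3 j = ?L b ^ j" for j unfolding b_def by (rule ratio_binomial[OF q4])
  have r6: "ratio A6 m2 j = ?L d ^ j" for j unfolding d_def by (rule ratio_binomial[OF q6])
  have "ratio A2 m3 1 $ 1 = ratio A1 m2 1 $ 1"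
    using first_level(1) pos by simp
  then have r1: "ratio A1 m2 j = ?L a ^ j" for j
    unfolding r1 r2 power_one_right L_nth_1 by simp
  have "ratio A4 m3 1 $ 1 = ratio A3 m1 1 $ 1"
    using xy.first_level(1) pos by simp
  then have r3: "ratio A3 m1 j = ?L b ^ j" for j
    unfolding r3 r4 power_one_right L_nth_1 by simp
  define p e1 e2 e3 t where "p = \<pi> 0 0 0" and "e1 = E1 $ 1" and "e2 = E2 $ 1" and "e3 = E3 $ 1"
    and "t = E1 $ 2"
  have nth_1: "(E * ?L c) $ 1 = E $ 1 + c" "(E * ?L c ^ 2) $ 1 = E $ 1 + 2 * c"
      "(E * ?L c ^ 3) $ 1 = E $ 1 + 3 * c" if "E $ 0 = 1" for E c
    using that by (simp_all add: fps_mult_nth_1 one_plus_X_power_nth choose_one)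
  have nth_2: "(E * ?L c) $ 2 = E $ 2 + c * E $ 1"
      "(E * ?L c ^ 2) $ 2 = E $ 2 + 2 * c * E $ 1 + c\<^sup>2" if "E $ 0 = 1" for E c
  proof -
    have mult_2: "(E * f) $ 2 = E $ 0 * f $ 2 + E $ 1 * f $ 1 + E $ 2 * f $ 0" for f
      by (simp add: fps_mult_nth numeral_2_eq_2 One_nat_def)
    show "(E * ?L c) $ 2 = E $ 2 + c * E $ 1"
        "(E * ?L c ^ 2) $ 2 = E $ 2 + 2 * c * E $ 1 + c\<^sup>2"
      unfolding mult_2 one_plus_X_power_nth using that by (simp_all add: choose_one)
  qed
  have p100: "\<pi> 1 0 0 = p * e1" by (subst eq1) (simp add: p_def e1_def)
  have p010: "\<pi> 0 1 0 = p * e2" by (subst eq2) (simp add: p_def e2_def)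
  have p001: "\<pi> 0 0 1 = p * e3" by (subst eq3) (simp add: p_def e3_def)
  have p200: "\<pi> 2 0 0 = p * t" by (subst eq1) (simp add: p_def t_def)
  have p011: "\<pi> 0 1 1 = p * e2 * (e3 + d)"
    using eq3[of 0 1 1] nth_1(1)[OF E_0(3), of d] by (simp add: p010 r6 e3_def)
  have p201: "\<pi> 2 0 1 = p * e3 * (t + a * e1)"
    using eq1[of 2 0 1] nth_2(1)[OF E_0(1), of a] by (simp add: p001 r2 e1_def t_def)
  have "\<pi> 2 1 0 = p * e2 * (t + a * e1)"
    using eq1[of 2 1 0] nth_2(1)[OF E_0(1), of a] by (simp add: p010 r1 e1_def t_def)
  moreover have "\<pi> 2 1 0 = p * t * (e2 + 2 * b)"
    using eq2[of 2 1 0] nth_1(2)[OF E_0(2), of b] by (simp add: p200 r3 e2_def)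
  ultimately have I1: "e2 * a * e1 = 2 * b * t"
    using origin by (simp add: p_def algebra_simps)
  have "\<pi> 2 1 1 = \<pi> 0 1 1 * (t + 2 * a * e1 + a\<^sup>2)"
    using eq1[of 2 1 1] nth_2(2)[OF E_0(1), of a]
    by (simp add: r1 r2 e1_def t_def power2_eq_square mult.assoc)
  moreover have "\<pi> 2 1 1 = \<pi> 2 0 1 * (e2 + 3 * b)"
    using eq2[of 2 1 1] nth_1(3)[OF E_0(2), of b]
    by (simp add: r3 r4 e2_def power2_eq_square power3_eq_cube mult.assoc)
  ultimately have I2: "e2 * (e3 + d) * (t + 2 * a * e1 + a\<^sup>2) = e3 * (t + a * e1) * (e2 + 3 * b)"
    using origin by (simp add: p011 p201 p_def)
  have I3: "e3 * b = e2 * d"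
    using first_level(3)[OF pos(2)] origin by (simp add: p001 p010 r4 r6 p_def)
  have I4: "e2 * a = e1 * b"
    using zx.first_level(3)[OF pos(1)] origin by (simp add: p100 p010 r1 r3 p_def)
  have nz: "e1 \<noteq> 0" "e2 \<noteq> 0" "e3 \<noteq> 0"
    using pos p100 p010 p001 by auto
  \<comment> \<open>The common factor between the odds \<open>a\<close>, \<open>b\<close>,
    \<open>d\<close> and the coefficients \<open>e1\<close>, \<open>e2\<close>, \<open>e3\<close>,
    respectively.\<close>
  define c where "c = b / e2"
  have c: "b = c * e2" "d = c * e3" "a = c * e1"
    using I3 I4 nz by (simp_all add: c_def field_simps)
  have "b \<noteq> 0" using q4 by (simp add: b_def)
  then have "c \<noteq> 0" using c(1) by auto
  then have t: "2 * t = e1\<^sup>2"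
    using I1 nz unfolding c by (simp add: power2_eq_square field_simps)
  have "(1 + c) * (2 * t + 4 * c * e1\<^sup>2 + 2 * c\<^sup>2 * e1\<^sup>2) = (2 * t + 2 * c * e1\<^sup>2) * (1 + 3 * c)"
  proof -
    have "e2 * e3 * ((1 + c) * (2 * t + 4 * c * e1\<^sup>2 + 2 * c\<^sup>2 * e1\<^sup>2)) =
        e2 * e3 * ((2 * t + 2 * c * e1\<^sup>2) * (1 + 3 * c))"
      using I2 unfolding c by (simp add: power2_eq_square algebra_simps)
    then show ?thesis using nz by simp
  qed
  then have "2 * c ^ 3 * e1\<^sup>2 = 0"
    unfolding t by (simp add: algebra_simps power2_eq_square power3_eq_cube)
  then show False using \<open>c \<noteq> 0\<close> nz by simp
qed

end

section \<open>Reduction to the normalized form\<close>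

lemma fps_mult_nth_ge:
  fixes f g :: "real fps"
  assumes "\<And>n. 0 \<le> f $ n" "\<And>n. 0 \<le> g $ n"
  shows "f $ i * g $ j \<le> (f * g) $ (i + j)"
proof -
  have "f $ i * g $ (i + j - i) \<le> (\<Sum>n = 0..i + j. f $ n * g $ (i + j - n))"
    by (rule member_le_sum) (use assms in auto)
  then show ?thesis by (simp add: fps_mult_nth)
qed

lemma fps_mult_nth_nonneg:
  fixes f g :: "real fps"
  assumes "\<And>n. 0 \<le> f $ n" "\<And>n. 0 \<le> g $ n"
  shows "0 \<le> (f * g) $ n"
  using assms by (auto simp: fps_mult_nth intro!: sum_nonneg)

text \<open>The generating function at conditioning values \<open>m\<close>, \<open>n\<close>,
  shifted to start at order 0 and scaled to constant term 1. It plays the role of the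
  \<open>E\<close> series in \<open>normalized_conditionals\<close>.\<close>

definition unit_part ::
  "real fps \<Rightarrow> (nat \<Rightarrow> real poly) \<Rightarrow> (nat \<Rightarrow> real poly) \<Rightarrow> nat \<Rightarrow> nat \<Rightarrow> real fps" where
  "unit_part E A B m n =
     fps_const (1 / (E $ subdegree E * coeff (A m) 0 * coeff (B n) 0)) *
     (fps_shift (subdegree E) E * fps_of_poly (A m) * fps_of_poly (B n))"

text \<open>The scalar in front depends on \<open>j\<close> and \<open>k\<close> but not on
  \<open>i\<close>, so it cancels when the coefficient at \<open>i\<close> is compared with that at
  0.\<close>

lemma unit_part_nth:
  assumes "bernoulli_family A" "bernoulli_family B" "E \<noteq> 0"
  shows "unit_part E A B m n $ 0 = 1"
    and "(E * fps_of_poly (A (m + j)) * fps_of_poly (B (n + k))) $ (subdegree E + i) =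
      E $ subdegree E * coeff (A (m + j)) 0 * coeff (B (n + k)) 0 *
      (unit_part E A B m n * ratio A m j * ratio B n k) $ i"
proof -
  interpret A: bernoulli_family A by fact
  interpret B: bernoulli_family B by fact
  let ?S = "fps_shift (subdegree E) E"
  have nz: "E $ subdegree E \<noteq> 0" "coeff (A l) 0 \<noteq> 0" "coeff (B l) 0 \<noteq> 0" for l
    using \<open>E \<noteq> 0\<close> A.coeff_0_pos[of l] B.coeff_0_pos[of l] by simp_all
  show "unit_part E A B m n $ 0 = 1"
    using nz by (simp add: unit_part_def)
  let ?K = "E $ subdegree E * coeff (A m) 0 * coeff (B n) 0"
  let ?F = "fps_of_poly (A (m + j)) * fps_of_poly (B (n + k))"
  have "unit_part E A B m n * ratio A m j * ratio B n k =
      fps_const (1 / ?K) * ?S * (ratio A m j * fps_of_poly (A m)) * (ratio B n k * fps_of_poly (B n))"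
    by (simp add: unit_part_def ac_simps)
  also have "\<dots> = fps_const (1 / ?K * A.norm_const m j * B.norm_const n k) * (?S * ?F)"
    unfolding A.ratio_mult B.ratio_mult fps_of_poly_smult fps_const_mult[symmetric]
    by (simp only: ac_simps)
  finally have "(unit_part E A B m n * ratio A m j * ratio B n k) $ i =
      1 / ?K * A.norm_const m j * B.norm_const n k * (?S * ?F) $ i"
    by simp
  moreover have "(E * ?F) $ (subdegree E + i) = (?S * ?F) $ i"
  proof -
    have "E * ?F = ?S * fps_X ^ subdegree E * ?F"
      by (simp only: subdegree_decompose[symmetric])
    then have "(E * ?F) $ (subdegree E + i) = (?S * ?F * fps_X ^ subdegree E) $ (subdegree E + i)"
      by (simp only: ac_simps)
    then show ?thesis unfolding fps_X_power_mult_right_nth by simp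
  qed
  ultimately show "(E * fps_of_poly (A (m + j)) * fps_of_poly (B (n + k))) $ (subdegree E + i) =
      E $ subdegree E * coeff (A (m + j)) 0 * coeff (B (n + k)) 0 *
      (unit_part E A B m n * ratio A m j * ratio B n k) $ i"
    using nz by (simp add: A.norm_const_def B.norm_const_def mult.assoc)
qed

text \<open>\<open>c1\<close>, \<open>c2\<close>, \<open>c3\<close> stand for the probabilities of
  the conditioning pairs and may vanish. \<open>nontrivial\<close> excludes the point mass at the
  origin.\<close>

locale compatible_conditionals =
  fixes \<pi> :: "nat \<Rightarrow> nat \<Rightarrow> nat \<Rightarrow> real"
    and c1 c2 c3 :: "nat \<Rightarrow> nat \<Rightarrow> real"
    and E1 E2 E3 :: "real fps"
    and A1 A2 A3 A4 A5 A6 :: "nat \<Rightarrow> real poly"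
  assumes fam1: "bernoulli_family A1" and fam2: "bernoulli_family A2"
    and fam3: "bernoulli_family A3" and fam4: "bernoulli_family A4"
    and fam5: "bernoulli_family A5" and fam6: "bernoulli_family A6"
    and E_nonneg: "\<And>n. 0 \<le> E1 $ n" "\<And>n. 0 \<le> E2 $ n" "\<And>n. 0 \<le> E3 $ n"
    and E_nonzero: "E1 \<noteq> 0" "E2 \<noteq> 0" "E3 \<noteq> 0"
    and c_nonneg: "\<And>y z. 0 \<le> c1 y z" "\<And>x z. 0 \<le> c2 x z" "\<And>x y. 0 \<le> c3 x y"
    and eq1: "\<pi> x y z = c1 y z * (E1 * fps_of_poly (A1 y) * fps_of_poly (A2 z)) $ x"
    and eq2: "\<pi> x y z = c2 x z * (E2 * fps_of_poly (A3 x) * fps_of_poly (A4 z)) $ y"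
    and eq3: "\<pi> x y z = c3 x y * (E3 * fps_of_poly (A5 x) * fps_of_poly (A6 y)) $ z"
    and nontrivial: "\<exists>x y z. 0 < \<pi> x y z \<and> (x \<noteq> 0 \<or> y \<noteq> 0 \<or> z \<noteq> 0)"
begin

lemma swap_YZ:
  "compatible_conditionals (\<lambda>x y z. \<pi> x z y) (\<lambda>y z. c1 z y) c3 c2 E1 E3 E2 A2 A1 A5 A6 A3 A4"
proof (rule compatible_conditionals.intro)
  show "\<pi> x z y = c1 z y * (E1 * fps_of_poly (A2 y) * fps_of_poly (A1 z)) $ x" for x y z
    by (subst eq1) (simp add: ac_simps)
  show "\<exists>x y z. 0 < \<pi> x z y \<and> (x \<noteq> 0 \<or> y \<noteq> 0 \<or> z \<noteq> 0)"
    using nontrivial by metis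
qed (fact fam1 fam2 fam3 fam4 fam5 fam6 E_nonneg E_nonzero c_nonneg eq2 eq3)+

lemma swap_XY:
  "compatible_conditionals (\<lambda>x y z. \<pi> y x z) c2 c1 (\<lambda>x y. c3 y x) E2 E1 E3 A3 A4 A1 A2 A6 A5"
proof (rule compatible_conditionals.intro)
  show "\<pi> y x z = c3 y x * (E3 * fps_of_poly (A6 x) * fps_of_poly (A5 y)) $ z" for x y z
    by (subst eq3) (simp add: ac_simps)
  show "\<exists>x y z. 0 < \<pi> y x z \<and> (x \<noteq> 0 \<or> y \<noteq> 0 \<or> z \<noteq> 0)"
    using nontrivial by metis
qed (fact fam1 fam2 fam3 fam4 fam5 fam6 E_nonneg E_nonzero c_nonneg eq1 eq2)+

section \<open>Moves inside the support\<close>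

abbreviation "m1 \<equiv> subdegree E1"
abbreviation "m2 \<equiv> subdegree E2"
abbreviation "m3 \<equiv> subdegree E3"

text \<open>\<open>X\<close> is redrawn given \<open>y\<close> and \<open>z\<close>, with least
  innovation \<open>m1\<close> and with \<open>i\<close> and \<open>j\<close> successes. As no
  success is always possible, \<open>m1\<close> is the least value of \<open>X\<close>.\<close>

lemma step_X:
  assumes "0 < \<pi> x y z" "0 < coeff (A1 y) i" "0 < coeff (A2 z) j"
  shows "0 < \<pi> (m1 + i + j) y z"
proof -
  interpret A1: bernoulli_family A1 by (fact fam1)
  interpret A2: bernoulli_family A2 by (fact fam2)
  have "0 < c1 y z"
    using assms(1) c_nonneg(1)[of y z] by (subst (asm) eq1) (auto simp: less_le)
  have "0 < E1 $ m1"
    using E_nonneg(1)[of m1] E_nonzero(1) by (simp add: less_le)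
  then have "0 < E1 $ m1 * coeff (A1 y) i * coeff (A2 z) j"
    using assms by simp
  also have "\<dots> \<le> (E1 * fps_of_poly (A1 y)) $ (m1 + i) * coeff (A2 z) j"
    using fps_mult_nth_ge[of E1 "fps_of_poly (A1 y)" m1 i] assms(3)
    by (intro mult_right_mono) (simp_all add: E_nonneg A1.coeff_nonneg)
  also have "\<dots> \<le> (E1 * fps_of_poly (A1 y) * fps_of_poly (A2 z)) $ (m1 + i + j)"
    using fps_mult_nth_ge[of "E1 * fps_of_poly (A1 y)" "fps_of_poly (A2 z)" "m1 + i" j]
    by (simp add: E_nonneg A1.coeff_nonneg A2.coeff_nonneg fps_mult_nth_nonneg)
  finally show ?thesis
    using \<open>0 < c1 y z\<close> by (subst eq1) simp
qed

text \<open>The extreme numbers of successes are always possible, even for parameters with values 0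
  and 1 only.\<close>

lemma X_moves:
  assumes "0 < \<pi> x y z"
  shows "0 < \<pi> m1 y z" "0 < \<pi> (m1 + y) y z" "0 < \<pi> (m1 + z) y z" "0 < \<pi> (m1 + y + z) y z"
  using step_X[OF assms, of 0 0] step_X[OF assms, of y 0] step_X[OF assms, of 0 z]
    step_X[OF assms, of y z]
  by (simp_all add: bernoulli_family.coeff_0_pos[OF fam1] bernoulli_family.coeff_0_pos[OF fam2]
      bernoulli_family.lead_pos[OF fam1] bernoulli_family.lead_pos[OF fam2])

lemma Y_moves:
  assumes "0 < \<pi> x y z"
  shows "0 < \<pi> x m2 z" "0 < \<pi> x (m2 + x) z"
  using compatible_conditionals.X_moves[OF swap_XY] assms by blast+

lemma Z_moves:
  assumes "0 < \<pi> x y z"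
  shows "0 < \<pi> x y m3" "0 < \<pi> x y (m3 + x + y)"
  using compatible_conditionals.X_moves[OF compatible_conditionals.swap_XY[OF swap_YZ]] assms
  by blast+

lemma support_X_pos: obtains x y z where "0 < \<pi> x y z" "0 < x"
  using nontrivial X_moves by (metis add_gr_0 neq0_conv)

text \<open>Raising \<open>X\<close> to \<open>m1 + y + z\<close> and then \<open>Z\<close> to its
  corresponding top value strictly increases \<open>Z\<close> while \<open>Y\<close> stays
  fixed.\<close>

lemma support_Z_unbounded:
  assumes "0 < \<pi> x y z" "0 < y"
  shows "\<exists>x z. 0 < \<pi> x y z \<and> n \<le> z"
proof (induction n)
  case 0
  show ?case using assms by blast
next
  case (Suc n)
  then obtain x z where "0 < \<pi> x y z" "n \<le> z" by blast
  have "0 < \<pi> (m1 + y + z) y (m3 + (m1 + y + z) + y)"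
    by (rule Z_moves(2)[OF X_moves(4)[OF \<open>0 < \<pi> x y z\<close>]])
  moreover have "Suc n \<le> m3 + (m1 + y + z) + y" using \<open>n \<le> z\<close> \<open>0 < y\<close> by simp
  ultimately show ?case by blast
qed

lemma normalized:
  "normalized_conditionals (\<lambda>i j k. \<pi> (m1 + i) (m2 + j) (m3 + k))
     (unit_part E1 A1 A2 m2 m3) (unit_part E2 A3 A4 m1 m3) (unit_part E3 A5 A6 m1 m2)
     A1 A2 A3 A4 A5 A6 m1 m2 m3"
proof (rule normalized_conditionals.intro)
  note nth = unit_part_nth[OF fam1 fam2 E_nonzero(1)] unit_part_nth[OF fam3 fam4 E_nonzero(2)]
    unit_part_nth[OF fam5 fam6 E_nonzero(3)]
  note r_0 = bernoulli_family.ratio_nth_0[OF fam1] bernoulli_family.ratio_nth_0[OF fam2]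
    bernoulli_family.ratio_nth_0[OF fam3] bernoulli_family.ratio_nth_0[OF fam4]
    bernoulli_family.ratio_nth_0[OF fam5] bernoulli_family.ratio_nth_0[OF fam6]
  show "unit_part E1 A1 A2 m2 m3 $ 0 = 1" "unit_part E2 A3 A4 m1 m3 $ 0 = 1"
    "unit_part E3 A5 A6 m1 m2 $ 0 = 1"
    by (fact nth)+
  fix i j k
  show "\<pi> (m1 + i) (m2 + j) (m3 + k) = \<pi> (m1 + 0) (m2 + j) (m3 + k) *
      (unit_part E1 A1 A2 m2 m3 * ratio A1 m2 j * ratio A2 m3 k) $ i"
    unfolding eq1 nth by (simp add: nth r_0)
  show "\<pi> (m1 + i) (m2 + j) (m3 + k) = \<pi> (m1 + i) (m2 + 0) (m3 + k) *
      (unit_part E2 A3 A4 m1 m3 * ratio A3 m1 i * ratio A4 m3 k) $ j"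
    unfolding eq2 nth by (simp add: nth r_0)
  show "\<pi> (m1 + i) (m2 + j) (m3 + k) = \<pi> (m1 + i) (m2 + j) (m3 + 0) *
      (unit_part E3 A5 A6 m1 m2 * ratio A5 m1 i * ratio A6 m2 j) $ k"
    unfolding eq3 nth by (simp add: nth r_0)
next
  \<comment> \<open>Lowering the coordinates one after another leads from any support point to the
    smallest one.\<close>
  obtain x y z where "0 < \<pi> x y z" by (rule support_X_pos)
  then have "0 < \<pi> m1 m2 m3" by (blast intro: X_moves Y_moves Z_moves)
  then show "\<pi> (m1 + 0) (m2 + 0) (m3 + 0) \<noteq> 0" by simp
qed (fact fam1 fam2 fam3 fam4 fam5 fam6)+

text \<open>By \<open>dichotomy\<close>, failure makes all inner coefficients vanish. Extreme moves
  still reach two support points with \<open>Y = m2 + x\<close> whose \<open>Z\<close> values differ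
  by more than \<open>x\<close>, which \<open>not_two_valued\<close> excludes with
  \<open>l = x\<close>.\<close>

lemma coeff_A3_pos:
  assumes "i \<le> k"
  shows "0 < coeff (A3 k) i"
proof (rule ccontr)
  assume "\<not> ?thesis"
  then have two: "coeff (A3 k) i = 0" if "0 < i" "i < k" for k i
    using bernoulli_family.dichotomy[OF fam3] that assms by blast
  obtain x y z where "0 < \<pi> x y z" "0 < x" by (rule support_X_pos)
  then have y: "0 < \<pi> x (m2 + x) z" by (intro Y_moves)
  then obtain x' z' where z': "0 < \<pi> x' (m2 + x) z'" "m3 + Suc x \<le> z'"
    using support_Z_unbounded[of x "m2 + x" z] \<open>0 < x\<close> by blast
  have "0 < \<pi> m1 (m2 + x) m3" "0 < \<pi> m1 (m2 + x) z'"
    using y z' by (blast intro: X_moves Z_moves)+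
  moreover have "x < z' - m3" using z'(2) by simp
  ultimately show False
    using normalized_conditionals.not_two_valued[OF normalized two, of x "z' - m3"] \<open>0 < x\<close> z'(2)
    by simp
qed

text \<open>Exactly one of the \<open>x\<close> trials has to succeed, which is where
  \<open>coeff_A3_pos\<close> is needed.\<close>

lemma Y_unit_step:
  assumes "0 < \<pi> x y z" "0 < x"
  shows "0 < \<pi> x (m2 + 1) z"
  using compatible_conditionals.step_X[OF swap_XY,
      where x = y and y = x and z = z and i = 1 and j = 0] assms coeff_A3_pos[of 1 x]
    bernoulli_family.coeff_0_pos[OF fam4] by simp

lemma contradiction: False
proof -
  interpret yz: compatible_conditionals "\<lambda>x y z. \<pi> x z y" "\<lambda>y z. c1 z y" c3 c2 E1 E3 E2
    A2 A1 A5 A6 A3 A4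
    by (fact swap_YZ)
  interpret xy: compatible_conditionals "\<lambda>x y z. \<pi> y x z" c2 c1 "\<lambda>x y. c3 y x" E2 E1 E3
    A3 A4 A1 A2 A6 A5
    by (fact swap_XY)
  interpret zy: compatible_conditionals "\<lambda>x y z. \<pi> z x y" "\<lambda>y z. c2 z y" "\<lambda>x y. c3 y x" c1 E2 E3 E1
    A4 A3 A6 A5 A1 A2
    by (fact xy.swap_YZ)
  interpret zx: compatible_conditionals "\<lambda>x y z. \<pi> y z x" c3 "\<lambda>y z. c1 z y" "\<lambda>x y. c2 y x" E3 E1 E2
    A5 A6 A2 A1 A4 A3
    by (fact yz.swap_XY)
  obtain x y z where "0 < \<pi> x y z" "0 < x" by (rule support_X_pos)
  then have "0 < \<pi> x m2 m3" by (blast intro: Y_moves Z_moves)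
  \<comment> \<open>A unit step needs a positive conditioning variable. At first this is
    \<open>x\<close>; afterwards the raised coordinates \<open>m2 + 1\<close> and
    \<open>m3 + 1\<close> serve.\<close>
  then have p010: "0 < \<pi> m1 (m2 + 1) m3" and p001: "0 < \<pi> m1 m2 (m3 + 1)"
    using Y_unit_step yz.Y_unit_step \<open>0 < x\<close> X_moves by blast+
  then have p110: "0 < \<pi> (m1 + 1) (m2 + 1) m3" and p101: "0 < \<pi> (m1 + 1) m2 (m3 + 1)"
    and p011: "0 < \<pi> m1 (m2 + 1) (m3 + 1)"
    using xy.Y_unit_step zx.Y_unit_step zy.Y_unit_step by auto
  have p100: "0 < \<pi> (m1 + 1) m2 m3"
    using p110 Y_moves by blast
  show False
    using normalized_conditionals.inconsistent[OF normalized] p100 p010 p001 p011 p101 p110 by simp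
qed

end

section \<open>From the probabilistic model to its algebraic form\<close>

theorem theorem5:
  fixes M :: "'a measure"
  shows "\<not> (\<exists>X Y Z W p \<epsilon>.
            random_coefficient_model M X Y Z W p \<epsilon> \<and>
            non_degenerate M W \<and>
            \<not> (AE \<omega> in M. X \<omega> = 0 \<and> Y \<omega> = 0 \<and> Z \<omega> = 0))"
proof
  assume "\<exists>X Y Z W p \<epsilon>.
            random_coefficient_model M X Y Z W p \<epsilon> \<and>
            non_degenerate M W \<and>
            \<not> (AE \<omega> in M. X \<omega> = 0 \<and> Y \<omega> = 0 \<and> Z \<omega> = 0)"
  then obtain X Y Z W p \<epsilon> where "random_coefficient_model M X Y Z W p \<epsilon>"
    and nondeg: "non_degenerate M W"
    and nonzero: "\<not> (AE \<omega> in M. X \<omega> = 0 \<and> Y \<omega> = 0 \<and> Z \<omega> = 0)"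
    by blast
  interpret random_coefficient_model M X Y Z W p \<epsilon> by fact
  note [measurable] = measurable_XYZ
  have fam: "bernoulli_family (mix_poly M (p j))" if "j \<in> {1..6}" for j
    using bernoulli_W[OF that] nondeg that
    by (intro random_parameter.bernoulli_family random_parameter_cond_iid_bernoulli)
       (auto simp: non_degenerate_def)
  note eqX = rc_equation_fps[OF equation_X bernoulli_W bernoulli_W measurable_XYZ]
    and eqY = rc_equation_fps[OF equation_Y bernoulli_W bernoulli_W measurable_XYZ(2,1,3)]
    and eqZ = rc_equation_fps[OF equation_Z bernoulli_W bernoulli_W measurable_XYZ(3,1,2)]
  let ?\<pi> = "\<lambda>x y z. prob {\<omega> \<in> space M. X \<omega> = x \<and> Y \<omega> = y \<and> Z \<omega> = z}"
  have "compatible_conditionals ?\<pi>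
      (\<lambda>y z. prob {\<omega> \<in> space M. Y \<omega> = y \<and> Z \<omega> = z})
      (\<lambda>x z. prob {\<omega> \<in> space M. X \<omega> = x \<and> Z \<omega> = z})
      (\<lambda>x y. prob {\<omega> \<in> space M. X \<omega> = x \<and> Y \<omega> = y})
      (pgf (\<epsilon> 1)) (pgf (\<epsilon> 2)) (pgf (\<epsilon> 3))
      (mix_poly M (p 1)) (mix_poly M (p 2)) (mix_poly M (p 3))
      (mix_poly M (p 4)) (mix_poly M (p 5)) (mix_poly M (p 6))"
  proof (rule compatible_conditionals.intro)
    show "pgf (\<epsilon> 1) \<noteq> 0" "pgf (\<epsilon> 2) \<noteq> 0" "pgf (\<epsilon> 3) \<noteq> 0"
      by (rule pgf_nonzero, rule eqX eqY eqZ; simp)+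
    fix x y z
    show "?\<pi> x y z = prob {\<omega> \<in> space M. Y \<omega> = y \<and> Z \<omega> = z} *
        (pgf (\<epsilon> 1) * fps_of_poly (mix_poly M (p 1) y) * fps_of_poly (mix_poly M (p 2) z)) $ x"
      by (rule eqX(2)) simp_all
    have "?\<pi> x y z = prob {\<omega> \<in> space M. Y \<omega> = y \<and> X \<omega> = x \<and> Z \<omega> = z}"
      by (simp add: conj_ac)
    also have "\<dots> = prob {\<omega> \<in> space M. X \<omega> = x \<and> Z \<omega> = z} *
        (pgf (\<epsilon> 2) * fps_of_poly (mix_poly M (p 3) x) * fps_of_poly (mix_poly M (p 4) z)) $ y"
      by (rule eqY(2)) simp_all
    finally show "?\<pi> x y z = \<dots>" .
    have "?\<pi> x y z = prob {\<omega> \<in> space M. Z \<omega> = z \<and> X \<omega> = x \<and> Y \<omega> = y}"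
      by (simp add: conj_ac)
    also have "\<dots> = prob {\<omega> \<in> space M. X \<omega> = x \<and> Y \<omega> = y} *
        (pgf (\<epsilon> 3) * fps_of_poly (mix_poly M (p 5) x) * fps_of_poly (mix_poly M (p 6) y)) $ z"
      by (rule eqZ(2)) simp_all
    finally show "?\<pi> x y z = \<dots>" .
  next
    \<comment> \<open>Otherwise every point but the origin has probability 0 and, by countability,
      all three variables vanish almost surely.\<close>
    show "\<exists>x y z. 0 < ?\<pi> x y z \<and> (x \<noteq> 0 \<or> y \<noteq> 0 \<or> z \<noteq> 0)"
    proof (rule ccontr)
      assume "\<not> ?thesis"
      then have le: "?\<pi> x y z \<le> 0" if "x \<noteq> 0 \<or> y \<noteq> 0 \<or> z \<noteq> 0" for x y z
        using that not_less by blast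
      have "AE \<omega> in M. (x \<noteq> 0 \<or> y \<noteq> 0 \<or> z \<noteq> 0) \<longrightarrow> \<not> (X \<omega> = x \<and> Y \<omega> = y \<and> Z \<omega> = z)" for x y z
      proof (cases "x \<noteq> 0 \<or> y \<noteq> 0 \<or> z \<noteq> 0")
        case True
        then have "?\<pi> x y z = 0" by (intro antisym le measure_nonneg)
        then have "AE \<omega> in M. \<omega> \<notin> {\<omega> \<in> space M. X \<omega> = x \<and> Y \<omega> = y \<and> Z \<omega> = z}"
          by (subst (asm) prob_eq_0) auto
        with AE_space show ?thesis by eventually_elim simp
      next
        case False
        then show ?thesis by auto
      qed
      then have "AE \<omega> in M. \<forall>x y z. (x \<noteq> 0 \<or> y \<noteq> 0 \<or> z \<noteq> 0) \<longrightarrow>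
          \<not> (X \<omega> = x \<and> Y \<omega> = y \<and> Z \<omega> = z)"
        unfolding AE_all_countable by blast
      then have "AE \<omega> in M. X \<omega> = 0 \<and> Y \<omega> = 0 \<and> Z \<omega> = 0"
      proof eventually_elim
        case (elim \<omega>)
        from spec[OF spec[OF spec[OF elim, of "X \<omega>"], of "Y \<omega>"], of "Z \<omega>"]
        show ?case by simp
      qed
      then show False using nonzero by blast
    qed
  qed (simp_all add: fam pgf_nonneg)
  then show False by (rule compatible_conditionals.contradiction)
qed

end
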